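(* Let $d\ge1$, $Q_d=(0,1)^d$, $A=\{0,a\}\subset\mathbb{R}^d$, and $\Omega=A+Q_d$, where $Q_d\cap(Q_d+a)=\varnothing$. Let $$\mathcal{L}=\{x=(x_1,\dots,x_d)\in\mathbb{R}^d:\ \exists\, i \text{ such that } x_i\in\mathbb{Z}\setminus\{0\}\}.$$ Then the following are equivalent: (1) $\Omega$ is a weak tile; (2) $\Omega$ is a tile; (3) $\Omega$ is a spectral set; (4) $a\in\mathcal{L}$.
   Context: Let $\Omega\subset\mathbb{R}^d$ be bounded and measurable with finite positive Lebesgue measure. $\Omega$ is a (translational) tile of $\mathbb{R}^d$ if there is a countable set $T\subset\mathbb{R}^d$ with $\sum_{t\in T}\mathbf{1}_\Omega(x-t)=1$ for a.e. $x\in\mathbb{R}^d$. $\Omega$ is a spectral set if there is a countable $\Lambda\subset\mathbb{R}^d$ such that $\{e^{2\pi i\langle\lambda,x\rangle}\}_{\lambda\in\Lambda}$ is an orthogonal basis of $L^2(\Omega)$. $\Omega$ is a weak tile of $\mathbb{R}^d$ if there is a positive (i.e. non-negative), locally finite Borel measure $\mu$ on $\mathbb{R}^d$ with $\mathbf{1}_\Omega*\mu=\mathbf{1}_{\Omega^c}$ a.e.; equivalently, there is a non-negative locally finite measure $\nu$ with $\mathbf{1}_\Omega*\nu=1$ a.e. and $\nu(\{0\})=1$. *)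

theory Defs
  imports "HOL-Analysis.Analysis" "HOL-Library.Set_Algebras"
begin

definition is_tile :: "'a::euclidean_space set \<Rightarrow> bool" where
  "is_tile \<Omega> \<longleftrightarrow>
     (\<exists>T. countable T \<and>
        (AE x in lebesgue. ((\<lambda>t. indicator \<Omega> (x - t) :: real) has_sum 1) T))"

definition locally_finite_measure :: "'a::topological_space measure \<Rightarrow> bool" where
  "locally_finite_measure \<mu> \<longleftrightarrow>
     (\<forall>x. \<exists>U. open U \<and> x \<in> U \<and> emeasure \<mu> U < \<infinity>)"

(* The integral is the value at x of the convolution of the indicator function of
   \<Omega> with \<mu>.  If \<Omega> is merely Lebesgue measurable, the integrand is
   measurable for the completion of \<mu> for almost every x, and for such x the
   integral with respect to \<mu> agrees with that with respect to the completion. *)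
definition is_weak_tile :: "'a::euclidean_space set \<Rightarrow> bool" where
  "is_weak_tile \<Omega> \<longleftrightarrow>
     (\<exists>\<mu>. sets \<mu> = sets borel \<and> locally_finite_measure \<mu> \<and>
        (AE x in lebesgue. (\<integral>\<^sup>+ t. indicator \<Omega> (x - t) \<partial>\<mu>) = indicator (- \<Omega>) x))"

definition L2_fun :: "'a measure \<Rightarrow> ('a \<Rightarrow> complex) set" where
  "L2_fun M = {f. f \<in> borel_measurable M \<and> integrable M (\<lambda>x. (norm (f x))\<^sup>2)}"

definition L2_inner :: "'a measure \<Rightarrow> ('a \<Rightarrow> complex) \<Rightarrow> ('a \<Rightarrow> complex) \<Rightarrow> complex" where
  "L2_inner M f g = (\<integral>x. f x * cnj (g x) \<partial>M)"

(* Elements of L2 are represented by functions, not by classes modulo null sets.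
   An orthogonal basis is an orthogonal family of nonzero vectors whose linear span
   is dense. *)
definition L2_orthogonal_basis :: "'a measure \<Rightarrow> ('i \<Rightarrow> 'a \<Rightarrow> complex) \<Rightarrow> 'i set \<Rightarrow> bool" where
  "L2_orthogonal_basis M e I \<longleftrightarrow>
     (\<forall>i\<in>I. e i \<in> L2_fun M \<and> L2_inner M (e i) (e i) \<noteq> 0) \<and>
     (\<forall>i\<in>I. \<forall>j\<in>I. i \<noteq> j \<longrightarrow> L2_inner M (e i) (e j) = 0) \<and>
     (\<forall>f\<in>L2_fun M. \<forall>\<epsilon>>0. \<exists>F c. finite F \<and> F \<subseteq> I \<and>
        sqrt (\<integral>x. (norm (f x - (\<Sum>i\<in>F. c i * e i x)))\<^sup>2 \<partial>M) < \<epsilon>)"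

definition expo :: "'a::real_inner \<Rightarrow> 'a \<Rightarrow> complex" where
  "expo \<xi> x = exp (2 * of_real pi * \<i> * of_real (\<xi> \<bullet> x))"

definition is_spectral_set :: "'a::euclidean_space set \<Rightarrow> bool" where
  "is_spectral_set \<Omega> \<longleftrightarrow>
     (\<exists>\<Lambda>. countable \<Lambda> \<and> L2_orthogonal_basis (lebesgue_on \<Omega>) expo \<Lambda>)"

definition unit_cube :: "(real ^ 'n) set" where
  "unit_cube = {x. \<forall>i. 0 < x $ i \<and> x $ i < 1}"

definition grid_set :: "(real ^ 'n) set" where
  "grid_set = {x. \<exists>i. x $ i \<in> \<int> - {0}}"

end

theory Submission
  imports Defs
begin

text \<open>Let \<open>Q\<close> be the unit cube. If \<open>a\<close> is not in the grid set, each coordinate of \<open>a\<close> is zero or not an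
  integer, so there is a product \<open>E\<close> of fundamental domains of \<open>\<real>/\<int>\<close> that contains both \<open>0\<close> and \<open>a\<close>.
  A weak tiling gives a measure \<open>\<sigma> \<ge> \<delta>\<^sub>0 + \<delta>\<^sub>a\<close> that has mass 1 on all translates of \<open>Q\<close>. Replacing the
  sides of \<open>Q\<close> by those of \<open>E\<close> one coordinate at a time gives \<open>\<sigma>(E) = 1\<close>, although \<open>\<sigma>(E) \<ge> 2\<close>.
  Dually, the exponentials of a spectrum of \<open>\<Omega>\<close> are also orthogonal for the weight \<open>1\<^sub>E + 1\<^bsub>E-a\<^esub>\<close>, because
  the Fourier transform of \<open>E\<close> vanishes where that of \<open>Q\<close> does. This weight has the same total mass 2
  but takes the value 2 near \<open>0\<close>, so that for the indicator of a small cube there Bessel's inequality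
  contradicts Parseval's identity on \<open>\<Omega>\<close>.
  Conversely, if \<open>a\<^sub>i = n\<close> is a nonzero integer, \<open>Q\<close> is a fundamental domain of the lattice generated by
  \<open>a / n\<close> and the other unit vectors, which gives a tiling and a spectrum explicitly.\<close>

section \<open>Weak tiles\<close>

text \<open>A weak tiling only controls almost every translate of the open cube, whereas exchanging
  sides needs every translate of the half-open one; the latter is a limit of good open cubes that
  approach strictly from one side. The exchange rests on periodicity: if all unit slabs in one
  coordinate have mass 1, shorter slabs keep their mass under integer shifts, so the pieces of a cut
  interval can be moved independently. For spectra only finite expansions enter. If \<open>p\<close>
  approximates the indicator of the small cube \<open>D\<close> for the first weight, then
  \<open>2 * p\<close> is its natural counterpart for the second, because the weight on
  \<open>D\<close> doubles while the total mass stays 2. The two squared errors satisfy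
  \<open>A2 = 4 * A1 - 2 * m\<close> with \<open>m\<close> the measure of \<open>D\<close>, which is
  negative for a good approximation. For the converse, a function on the two cubes is a pair of
  functions on one cube. Half the sum is expanded in frequencies periodic under \<open>a\<close>,
  half the difference in the same frequencies shifted by a vector with inner product 1/2 with
  \<open>a\<close>. Density on one cube comes from Stone-Weierstrass on its image in a
  torus.\<close>

lemma unit_cube_eq_box: "unit_cube = box 0 (1::real^'n)"
  by (auto simp: unit_cube_def mem_box_cart)

lemma slab_measurable:
  fixes g :: "'b \<Rightarrow> real"
  assumes [measurable]: "g \<in> borel_measurable M" and C: "C \<in> sets M"
  shows "{t \<in> C. u \<le> g t \<and> g t < v} \<in> sets M"
proof -
  have "{t \<in> C. u \<le> g t \<and> g t < v} = C \<inter> {t \<in> space M. u \<le> g t \<and> g t < v}"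
    using sets.sets_into_space[OF C] by auto
  then show ?thesis using C by simp
qed

text \<open>The slabs over [y, z) and [z, y + 1) together have mass 1, and so do those over [z, y +
  1) and [y + 1, z + 1). Cancelling the common slab gives invariance under a shift by 1.\<close>

lemma slab_periodic:
  fixes M :: "'b measure" and g :: "'b \<Rightarrow> real"
  assumes g[measurable]: "g \<in> borel_measurable M" and C[measurable]: "C \<in> sets M"
    and one: "\<And>y. emeasure M {t \<in> C. y \<le> g t \<and> g t < y + 1} = 1"
    and yz: "y \<le> z" "z \<le> y + 1"
  shows "emeasure M {t \<in> C. y + of_int k \<le> g t \<and> g t < z + of_int k} = emeasure M {t \<in> C. y \<le> g t \<and> g t < z}"
proof -
  note meas = slab_measurable[OF g C]
  define G where "G u v = emeasure M {t \<in> C. u \<le> g t \<and> g t < v}" for u v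
  have add: "G u v + G v w = G u w" if "u \<le> v" "v \<le> w" for u v w
    unfolding G_def using that
    by (subst plus_emeasure[OF meas meas]) (auto intro!: arg_cong[where f="emeasure M"])
  have G1: "G u (u + 1) = 1" for u using one[of u] by (simp add: G_def)
  have step: "G (u + 1) (v + 1) = G u v" if "u \<le> v" "v \<le> u + 1" for u v
  proof -
    have "G v (u + 1) + G u v = G v (u + 1) + G (u + 1) (v + 1)"
      using add[of u v "u + 1"] add[of v "u + 1" "v + 1"] that G1[of u] G1[of v] by (simp add: add.commute)
    \<comment> \<open>Cancellation in \<open>ennreal\<close> requires the common slab to be
      finite.\<close>
    moreover have "G v (u + 1) \<noteq> top"
    proof -
      have "G v (u + 1) \<le> G u (u + 1)" unfolding G_def using that
        by (intro emeasure_mono meas) auto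
      then show ?thesis using G1[of u] by (auto simp: top_unique)
    qed
    ultimately show ?thesis by (simp add: ennreal_add_left_cancel)
  qed
  have nat: "G (u + of_nat m) (v + of_nat m) = G u v" if "u \<le> v" "v \<le> u + 1" for u v m
  proof (induction m)
    case (Suc m)
    have "G (u + of_nat (Suc m)) (v + of_nat (Suc m)) = G (u + of_nat m + 1) (v + of_nat m + 1)"
      by (simp add: ac_simps)
    then show ?case using Suc step[of "u + of_nat m" "v + of_nat m"] that by simp
  qed simp
  have "G (y + of_int k) (z + of_int k) = G y z"
  proof (cases k)
    case (nonneg m)
    then show ?thesis using nat[OF yz, of m] by simp
  next
    case (neg m)
    \<comment> \<open>For negative \<open>k\<close> the forward shift by \<open>Suc m\<close> is
      applied to the already shifted interval and leads back to the original one.\<close>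
    then show ?thesis using nat[of "y + of_int k" "z + of_int k" "Suc m"] yz by (simp add: add.assoc)
  qed
  then show ?thesis by (simp add: G_def)
qed

text \<open>A fundamental domain of \<open>\<real>/\<int>\<close>, which contains both \<open>0\<close> and \<open>s\<close> unless \<open>s\<close> is a nonzero integer.\<close>

definition split_interval :: "real \<Rightarrow> real set" where
  "split_interval s = {0..<frac s} \<union> {s..<1 + of_int \<lfloor>s\<rfloor>}"

lemma frac_floor_eq: "frac s + of_int \<lfloor>s\<rfloor> = (s::real)"
  by (simp add: frac_def)

text \<open>\<open>s\<close> is the left end of the second piece, and 0 that of the first as soon as
  \<open>frac s\<close> is positive. Only a nonzero integer \<open>s\<close> loses 0: its first
  piece is empty and the second is [s, s + 1).\<close>

lemma split_interval_mems:
  assumes "s \<in> \<int> \<Longrightarrow> s = 0"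
  shows "0 \<in> split_interval s" "s \<in> split_interval s"
proof -
  have "frac s > 0 \<or> s = 0" using assms frac_eq_0_iff[of s] frac_ge_0[of s] by force
  then show "0 \<in> split_interval s" by (auto simp: split_interval_def)
  show "s \<in> split_interval s" unfolding split_interval_def
    by (metis UnCI add.commute atLeastLessThan_iff floor_eq_iff order_refl)
qed

text \<open>A common point would have floor 0 and floor \<open>\<lfloor>s\<rfloor>\<close> at once.
  Then \<open>frac s = s\<close>, so the second piece would begin only where the first one
  ends.\<close>

lemma split_interval_disjoint: "x \<in> {0..<frac s} \<Longrightarrow> x \<notin> {s..<1 + of_int \<lfloor>s\<rfloor>}" for s :: real
proof
  assume x: "x \<in> {0..<frac s}" "x \<in> {s..<1 + of_int \<lfloor>s\<rfloor>}"
  then have "\<lfloor>x\<rfloor> = 0" using frac_lt_1[of s] by (simp add: floor_eq_iff)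
  moreover have "\<lfloor>x\<rfloor> = \<lfloor>s\<rfloor>" using x by (simp add: floor_eq_iff) linarith
  ultimately have "frac s = s" by (simp add: frac_def)
  then show False using x by simp
qed

lemma split_interval_measurable[measurable]: "split_interval s \<in> sets borel"
  by (simp add: split_interval_def)

text \<open>The second piece of the interval is [frac s, 1) moved by the integer
  \<open>\<lfloor>s\<rfloor>\<close>. Moving it back by \<open>slab_periodic\<close> completes the
  first piece to [0, 1).\<close>

lemma slab_split_interval:
  fixes M :: "'b measure" and g :: "'b \<Rightarrow> real"
  assumes g[measurable]: "g \<in> borel_measurable M" and C[measurable]: "C \<in> sets M"
    and one: "\<And>y. emeasure M {t \<in> C. y \<le> g t \<and> g t < y + 1} = 1"
  shows "emeasure M {t \<in> C. g t \<in> split_interval s} = 1"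
proof -
  note meas = slab_measurable[OF g C]
  let ?f = "frac s" and ?k = "\<lfloor>s\<rfloor>"
  have f: "0 \<le> ?f" "?f < 1" by (auto simp: frac_lt_1)
  have disj: "\<not> (t < ?f \<and> 0 \<le> t \<and> s \<le> t \<and> t < 1 + of_int ?k)" for t
    using split_interval_disjoint[of t s] unfolding atLeastLessThan_iff by blast
  have "emeasure M {t \<in> C. g t \<in> split_interval s} =
        emeasure M {t \<in> C. 0 \<le> g t \<and> g t < ?f} + emeasure M {t \<in> C. s \<le> g t \<and> g t < 1 + of_int ?k}"
    using disj by (subst plus_emeasure[OF meas meas]) (auto simp: split_interval_def intro!: arg_cong[where f="emeasure M"])
  also have "emeasure M {t \<in> C. s \<le> g t \<and> g t < 1 + of_int ?k} = emeasure M {t \<in> C. ?f \<le> g t \<and> g t < 1}"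
    using slab_periodic[OF g C one, of ?f 1 ?k] f by (simp add: frac_floor_eq)
  also have "emeasure M {t \<in> C. 0 \<le> g t \<and> g t < ?f} + \<dots> = emeasure M {t \<in> C. 0 \<le> g t \<and> g t < 0 + 1}"
    using f by (subst plus_emeasure[OF meas meas]) (auto intro!: arg_cong[where f="emeasure M"] intro: order_trans[OF f(1)])
  finally show ?thesis using one by metis
qed

text \<open>Induction on the set \<open>I\<close> of coordinates whose unit side has already been
  exchanged. The corner \<open>x\<close> stays arbitrary, because the step needs all translates in
  the next coordinate.\<close>

lemma box_split_intervals:
  fixes M :: "(real ^ 'n) measure"
  assumes M: "sets M = sets borel"
    and one: "\<And>x. emeasure M {t. \<forall>i. x $ i \<le> t $ i \<and> t $ i < x $ i + 1} = 1"
  shows "emeasure M {t. \<forall>i. t $ i \<in> split_interval (a $ i)} = 1"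
proof -
  note [measurable_cong] = M
  have sp[simp]: "space M = UNIV" using sets_eq_imp_space_eq[OF M] by simp
  have c[measurable]: "(\<lambda>t. t $ i) \<in> borel_measurable M" for i
    using measurable_cong_sets[OF M refl, of "borel::real measure"] by auto
  have "emeasure M {t. \<forall>i. if i \<in> I then t $ i \<in> split_interval (a $ i) else x $ i \<le> t $ i \<and> t $ i < x $ i + 1} = 1"
    (is "?P I x")
    for I x
  proof (induction I arbitrary: x rule: finite_induct[OF finite])
    case 1
    then show ?case using one by simp
  next
    case (2 j I)
    define C where "C = {t. \<forall>i. i \<noteq> j \<longrightarrow> (if i \<in> I then t $ i \<in> split_interval (a $ i) else x $ i \<le> t $ i \<and> t $ i < x $ i + 1)}"
    have "{t \<in> space M. \<forall>i. i \<noteq> j \<longrightarrow> (if i \<in> I then t $ i \<in> split_interval (a $ i) else x $ i \<le> t $ i \<and> t $ i < x $ i + 1)} \<in> sets M"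
      by measurable
    then have C: "C \<in> sets M" by (simp add: C_def)
    \<comment> \<open>Replacing coordinate \<open>j\<close> of the corner by \<open>y\<close> turns
      this slab of \<open>C\<close> into a set covered by the induction hypothesis.\<close>
    have "emeasure M {t \<in> C. y \<le> t $ j \<and> t $ j < y + 1} = 1" for y
    proof -
      have "{t \<in> C. y \<le> t $ j \<and> t $ j < y + 1} =
        {t. \<forall>i. if i \<in> I then t $ i \<in> split_interval (a $ i)
          else (\<chi> i. if i = j then y else x $ i) $ i \<le> t $ i \<and> t $ i < (\<chi> i. if i = j then y else x $ i) $ i + 1}"
        (is "?L = {t. \<forall>i. ?R t i}")
      proof (rule set_eqI)
        fix t
        have all_split: "(\<forall>i. P i) \<longleftrightarrow> P j \<and> (\<forall>i. i \<noteq> j \<longrightarrow> P i)" for P :: "'n \<Rightarrow> bool" by (metis (full_types))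
        have "(\<forall>i. ?R t i) \<longleftrightarrow> ?R t j \<and> (\<forall>i. i \<noteq> j \<longrightarrow> ?R t i)" by (rule all_split)
        also have "\<dots> \<longleftrightarrow> t \<in> ?L" using 2(2) by (auto simp: C_def)
        finally show "t \<in> ?L \<longleftrightarrow> t \<in> {t. \<forall>i. ?R t i}" by simp
      qed
      then show ?thesis using "2.IH" by simp
    qed
    from slab_split_interval[OF c C this, of "a $ j"]
    have "emeasure M {t \<in> C. t $ j \<in> split_interval (a $ j)} = 1" .
    moreover have "{t \<in> C. t $ j \<in> split_interval (a $ j)} = {t. \<forall>i. if i \<in> insert j I then t $ i \<in> split_interval (a $ i)
          else x $ i \<le> t $ i \<and> t $ i < x $ i + 1}" by (auto simp: C_def)
    ultimately show ?case by simp
  qed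
  from this[of UNIV] show ?thesis by simp
qed

lemma not_grid_split_interval:
  fixes a :: "real ^ 'n"
  assumes "a \<notin> grid_set"
  shows "0 \<in> split_interval (a $ i)" "a $ i \<in> split_interval (a $ i)"
  using assms by (auto simp: grid_set_def intro!: split_interval_mems)

section \<open>From almost every open cube to every half-open cube\<close>

lemma AE_lebesgue_ex_open:
  fixes U :: "'a::euclidean_space set"
  assumes "AE x in lebesgue. P x" "open U" "U \<noteq> {}"
  shows "\<exists>x\<in>U. P x"
proof (rule ccontr)
  assume n: "\<not> (\<exists>x\<in>U. P x)"
  obtain N where N: "{x \<in> space lebesgue. \<not> P x} \<subseteq> N" "emeasure lebesgue N = 0" "N \<in> sets lebesgue"
    using AE_E[OF assms(1)] by blast
  have "U \<subseteq> N" using n N(1) by auto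
  then have "negligible U" using N by (meson negligible_iff_null_sets negligible_subset null_setsI)
  then show False using open_not_negligible assms by blast
qed

lemma locally_finite_compact:
  assumes "locally_finite_measure \<mu>" "sets \<mu> = sets (borel :: 'a::topological_space measure)" "compact (K :: 'a set)"
  shows "emeasure \<mu> K < \<infinity>"
proof -
  from assms(1) obtain U where U: "\<And>x. open (U x) \<and> x \<in> U x \<and> emeasure \<mu> (U x) < \<infinity>"
    unfolding locally_finite_measure_def by metis
  obtain D where D: "D \<subseteq> K" "finite D" "K \<subseteq> (\<Union>x\<in>D. U x)"
    by (rule compactE_image[OF assms(3), of K U]) (use U in blast)+
  have m: "U x \<in> sets \<mu>" for x using U assms(2) by auto
  have "emeasure \<mu> K \<le> emeasure \<mu> (\<Union>x\<in>D. U x)" using m D by (intro emeasure_mono) auto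
  also have "\<dots> \<le> (\<Sum>x\<in>D. emeasure \<mu> (U x))" using m D by (intro emeasure_subadditive_finite) auto
  also have "\<dots> < \<infinity>" using D(2) U by (induction D rule: finite_induct) auto
  finally show ?thesis .
qed

text \<open>In each coordinate, \<open>y - t\<close> lies in the unit interval iff t is in (y - 1,
  y). As y tends to x + 1 strictly from below, these intervals converge pointwise to [x, x + 1): the
  left end is always included, the right end never. Good values of y exist in every small box, and
  dominated convergence passes to the limit.\<close>

lemma half_open_cube_measure:
  fixes M :: "(real ^ 'n) measure"
  assumes M: "sets M = sets borel" and fin: "\<And>K. compact K \<Longrightarrow> emeasure M K < \<infinity>"
    and ae: "AE x in lebesgue. emeasure M {t. x - t \<in> unit_cube} = 1"
  shows "emeasure M {t. \<forall>i. x $ i \<le> t $ i \<and> t $ i < x $ i + 1} = 1"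
proof -
  note [measurable_cong] = M
  have sp[simp]: "space M = UNIV" using sets_eq_imp_space_eq[OF M] by simp
  define z where "z = (\<chi> i. x $ i + 1)"
  have "\<exists>y. (\<forall>i. z $ i - 1 / Suc n < y $ i \<and> y $ i < z $ i) \<and> emeasure M {t. y - t \<in> unit_cube} = 1" for n
  proof -
    have "box (\<chi> i. z $ i - 1 / Suc n) z \<noteq> {}" by (simp add: box_ne_empty Basis_vec_def inner_axis)
    from AE_lebesgue_ex_open[OF ae open_box this] obtain y where
      "y \<in> box (\<chi> i. z $ i - 1 / Suc n) z" "emeasure M {t. y - t \<in> unit_cube} = 1" by blast
    then show ?thesis by (intro exI[of _ y]) (auto simp: mem_box_cart)
  qed
  then obtain y where y: "\<And>n i. z $ i - 1 / Suc n < y n $ i" "\<And>n i. y n $ i < z $ i"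
     "\<And>n. emeasure M {t. y n - t \<in> unit_cube} = 1" by metis
  \<comment> \<open>Since \<open>y n\<close> exceeds \<open>z - 1\<close> in each coordinate, all
    approximating cubes lie in this compact box; its finite mass gives the dominating
    function.\<close>
  define K where "K = cbox (\<chi> i. z $ i - 2) z"
  have lim: "(\<lambda>n. y n $ i) \<longlonglongrightarrow> z $ i" for i
  proof (rule tendsto_sandwich[of "\<lambda>n. z $ i - 1 / Suc n" _ _ "\<lambda>_. z $ i"])
    show "(\<lambda>n. z $ i - 1 / Suc n) \<longlonglongrightarrow> z $ i"
      using tendsto_diff[OF tendsto_const[of "z $ i"] LIMSEQ_inverse_real_of_nat] by (simp add: inverse_eq_divide)
  qed (use y in \<open>auto intro!: always_eventually less_imp_le\<close>)
  let ?B = "\<lambda>n. {t. y n - t \<in> unit_cube}" and ?H = "{t. \<forall>i. x $ i \<le> t $ i \<and> t $ i < x $ i + 1}"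
  have o: "open (unit_cube :: (real^'n) set)" unfolding unit_cube_eq_box by (rule open_box)
  have "open (?B n)" for n using open_vimage[OF o, of "\<lambda>t. y n - t"] by (simp add: vimage_def continuous_intros)
  then have Bm: "?B n \<in> sets M" for n using M by simp
  have "{t \<in> space M. \<forall>i. x $ i \<le> t $ i \<and> t $ i < x $ i + 1} \<in> sets M"
    by measurable
  then have Hm: "?H \<in> sets M" by simp
  have conv: "(\<lambda>n. indicator (?B n) t :: ennreal) \<longlonglongrightarrow> indicator ?H t" for t
  proof -
    have "\<forall>\<^sub>F n in sequentially. (0 < y n $ i - t $ i \<and> y n $ i - t $ i < 1) = (x $ i \<le> t $ i \<and> t $ i < x $ i + 1)" for i
    proof -
      consider "t $ i < x $ i" | "x $ i \<le> t $ i" "t $ i < z $ i" | "z $ i \<le> t $ i" by linarith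
      then show ?thesis
      proof cases
        case 1
        then have "t $ i + 1 < z $ i" by (simp add: z_def)
        from order_tendstoD(1)[OF lim[of i] this] show ?thesis
          by (rule eventually_mono) (use 1 in auto)
      next
        case 2
        have "y n $ i < t $ i + 1" for n using y(2)[of n i] 2 by (simp add: z_def)
        then show ?thesis using order_tendstoD(1)[OF lim[of i] 2(2)] 2
          by (auto simp: z_def algebra_simps elim!: eventually_mono)
      next
        case 3
        then have "y n $ i < t $ i" for n using y(2)[of n i] by simp
        then show ?thesis using 3 by (auto simp: z_def not_less less_imp_le)
      qed
    qed
    then have "\<forall>\<^sub>F n in sequentially. \<forall>i. (0 < y n $ i - t $ i \<and> y n $ i - t $ i < 1) = (x $ i \<le> t $ i \<and> t $ i < x $ i + 1)"
      by (rule eventually_all_finite)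
    then have "\<forall>\<^sub>F n in sequentially. indicator (?B n) t = (indicator ?H t :: ennreal)"
      by (rule eventually_mono) (auto simp: indicator_def unit_cube_def)
    then show ?thesis by (rule tendsto_eventually)
  qed
  have "(\<lambda>n. \<integral>\<^sup>+t. indicator (?B n) t \<partial>M) \<longlonglongrightarrow> (\<integral>\<^sup>+t. indicator ?H t \<partial>M)"
  proof (rule nn_integral_dominated_convergence[where w="indicator K"])
    have "compact K" by (simp add: K_def)
    then show "(\<integral>\<^sup>+t. indicator K t \<partial>M) < \<infinity>" using fin M by (subst nn_integral_indicator) (auto simp: K_def)
    show "AE t in M. indicator (?B n) t \<le> (indicator K t :: ennreal)" for n
    proof (rule AE_I2)
      fix t
      have "t \<in> K" if t: "t \<in> ?B n"
      proof -
        have "z $ i - 2 \<le> t $ i \<and> t $ i \<le> z $ i" for i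
        proof -
          have "0 < y n $ i - t $ i" "y n $ i - t $ i < 1" using t by (simp_all add: unit_cube_def)
          moreover have "1 / real (Suc n) \<le> 1" by simp
          ultimately show ?thesis using y(1)[of i n] y(2)[of n i] by linarith
        qed
        then show ?thesis by (auto simp: K_def mem_box_cart)
      qed
      then show "indicator (?B n) t \<le> (indicator K t :: ennreal)" by (auto simp: indicator_def)
    qed
  qed (use Bm Hm conv M in \<open>auto simp: K_def\<close>)
  then show ?thesis using Bm Hm y(3) by (simp add: nn_integral_indicator LIMSEQ_const_iff)
qed


lemma two_cubes_mem: "x \<in> {0, a} + (S :: 'a::ab_group_add set) \<longleftrightarrow> x \<in> S \<or> x - a \<in> S"
proof -
  have "{0, a} + S = S \<union> (+) a ` S" by (auto simp: set_plus_def image_iff)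
  then show ?thesis by (auto simp: image_iff) (metis add_diff_cancel_left' diff_add_cancel add.commute)+
qed

lemma two_cubes_disjoint:
  fixes a :: "'a::ab_group_add"
  assumes "S \<inter> (\<lambda>x. x + a) ` S = {}"
  shows "\<not> (x \<in> S \<and> x - a \<in> S)"
proof
  assume "x \<in> S \<and> x - a \<in> S"
  then have "x \<in> S \<inter> (\<lambda>x. x + a) ` S" by (auto intro!: image_eqI[of _ _ "x - a"])
  then show False using assms by simp
qed

lemma weak_tile_imp_grid_set:
  fixes a :: "real ^ 'n"
  assumes disj: "unit_cube \<inter> (\<lambda>x. x + a) ` unit_cube = {}"
    and weak: "is_weak_tile ({0, a} + unit_cube)"
  shows "a \<in> grid_set"
proof (rule ccontr)
  assume a: "a \<notin> grid_set"
  obtain \<mu> :: "(real ^ 'n) measure" where \<mu>: "sets \<mu> = sets borel" "locally_finite_measure \<mu>"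
    and ae: "AE x in lebesgue. (\<integral>\<^sup>+ t. indicator ({0, a} + unit_cube) (x - t) \<partial>\<mu>) = indicator (- ({0, a} + unit_cube)) x"
    using weak unfolding is_weak_tile_def by blast
  note ndisj = two_cubes_disjoint[OF disj]
  have "a \<noteq> 0"
  proof
    assume "a = 0"
    moreover have "(\<chi> i. 1/2) \<in> (unit_cube :: (real^'n) set)" by (simp add: unit_cube_def)
    ultimately show False using disj by auto
  qed
  note [measurable_cong] = \<mu>(1)
  have sp[simp]: "space \<mu> = UNIV" using sets_eq_imp_space_eq[OF \<mu>(1)] by simp
  \<comment> \<open>\<open>s\<close> is \<open>(\<mu> + \<delta>\<^sub>0) * (\<delta>\<^sub>0 + \<delta>\<^sub>a)\<close>, so that \<open>\<Omega> * (\<mu> + \<delta>\<^sub>0) = 1\<close> becomes \<open>unit_cube * s = 1\<close>.\<close>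
  define s where "s B = emeasure \<mu> B + emeasure \<mu> ((\<lambda>t. t + a) -` B) + indicator B 0 + indicator B a" for B
  have shift: "(\<lambda>t. t + a) -` B \<in> sets borel" if "B \<in> sets borel" for B
    using measurable_sets_borel[of "\<lambda>t. t + a" borel B] that by simp
  define M where "M = measure_of UNIV (sets borel) s"
  have M: "sets M = sets borel" unfolding M_def
    using sets.sigma_sets_eq[of "borel :: (real^'n) measure"] by (simp add: sets_measure_of_conv)
  have sM: "emeasure M B = s B" if "B \<in> sets borel" for B
  proof (rule emeasure_measure_of[OF M_def])
    show "countably_additive (sets M) s"
    proof (rule countably_additiveI)
      fix A :: "nat \<Rightarrow> (real^'n) set"
      assume A: "range A \<subseteq> sets M" "disjoint_family A"
      have ind: "(\<Sum>i. indicator (A i) x) = (indicator (\<Union>i. A i) x :: ennreal)" for x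
        using suminf_indicator[OF A(2)] .
      have 1: "(\<Sum>i. emeasure \<mu> (A i)) = emeasure \<mu> (\<Union>i. A i)"
        using A M \<mu> by (intro suminf_emeasure) auto
      have 2: "(\<Sum>i. emeasure \<mu> ((\<lambda>t. t + a) -` A i)) = emeasure \<mu> ((\<lambda>t. t + a) -` (\<Union>i. A i))"
        unfolding vimage_UN using A M \<mu> shift by (intro suminf_emeasure) (auto simp: disjoint_family_on_def)
      show "(\<Sum>i. s (A i)) = s (\<Union>i. A i)"
        unfolding s_def by (simp add: suminf_add[symmetric] ind 1 2)
    qed
  qed (use that M in \<open>auto simp: positive_def s_def\<close>)
  have cpt: "emeasure M K < \<infinity>" if "compact K" for K
  proof -
    have "compact ((\<lambda>t. t + a) -` K)"
    proof -
      have "(\<lambda>t. t + a) -` K = (\<lambda>t. t - a) ` K" by (auto simp: image_iff) (metis add_diff_cancel)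
      moreover have "compact \<dots>" using that by (intro compact_continuous_image continuous_intros)
      ultimately show ?thesis by simp
    qed
    then show ?thesis using locally_finite_compact[OF \<mu>(2,1)] that
      by (auto simp: sM s_def borel_compact indicator_def)
  qed
  have op: "open {t. x - t \<in> unit_cube}" for x :: "real^'n"
    using open_vimage[OF open_box, of "\<lambda>t. x - t" 0 1] unfolding unit_cube_eq_box
    by (simp add: vimage_def continuous_intros)
  have opm: "{t. x - t \<in> unit_cube} \<in> sets borel" for x :: "real^'n" using op by simp
  have "AE x in lebesgue. emeasure M {t. x - t \<in> unit_cube} = 1"
    using ae
  proof (rule eventually_mono)
    fix x
    assume x: "(\<integral>\<^sup>+ t. indicator ({0, a} + unit_cube) (x - t) \<partial>\<mu>) = indicator (- ({0, a} + unit_cube)) x"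
    let ?A = "{t. x - t \<in> unit_cube}" and ?B = "(\<lambda>t. t + a) -` {t. x - t \<in> unit_cube}"
    have "(\<integral>\<^sup>+ t. indicator ({0, a} + unit_cube) (x - t) \<partial>\<mu>) = (\<integral>\<^sup>+ t. indicator (?A \<union> ?B) t \<partial>\<mu>)"
      by (intro nn_integral_cong) (auto simp: indicator_def two_cubes_mem diff_diff_eq)
    also have "\<dots> = emeasure \<mu> (?A \<union> ?B)"
      using opm shift[OF opm] \<mu> by (intro nn_integral_indicator) auto
    also have "\<dots> = emeasure \<mu> ?A + emeasure \<mu> ?B"
      using opm[of x] shift[OF opm] \<mu> ndisj[of "x - t" for t]
      by (intro plus_emeasure[symmetric]) (auto simp: diff_diff_eq)
    finally have "emeasure \<mu> ?A + emeasure \<mu> ?B = indicator (- ({0, a} + unit_cube)) x" using x by simp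
    \<comment> \<open>The two point masses of \<open>s\<close> contribute the indicators of x in Q
      and of x - a in Q. By disjointness their sum is the indicator of \<Omega> at x, which
      completes the indicator of the complement to 1.\<close>
    then show "emeasure M ?A = 1"
      using ndisj[of x] by (auto simp: sM opm s_def indicator_def two_cubes_mem)
  qed
  note one = box_split_intervals[OF M half_open_cube_measure[OF M cpt this], of a]
  let ?E = "{t. \<forall>i. t $ i \<in> split_interval (a $ i)}"
  \<comment> \<open>\<open>emeasure\<close> is 0 outside the sigma-algebra, so having mass 1 already
    proves measurability.\<close>
  have "?E \<in> sets M" using one emeasure_notin_sets[of ?E M] by fastforce
  moreover have "0 \<in> ?E" "a \<in> ?E" using not_grid_split_interval[OF a] by auto
  ultimately have "2 \<le> emeasure M ?E"
    by (auto simp: sM M s_def add.assoc intro!: add_increasing)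
  then show False using one by simp
qed

section \<open>Tiles\<close>

lemma open_unit_cube: "open unit_cube"
  unfolding unit_cube_eq_box by (rule open_box)

text \<open>No covering index gives the sum 0, and two of them already give a partial sum 2. Tilings
  can thus be treated pointwise as unique existence.\<close>

lemma has_sum_indicator_one_iff:
  "((\<lambda>t. indicator (S t) x :: real) has_sum 1) T \<longleftrightarrow> (\<exists>!t. t \<in> T \<and> x \<in> S t)"
proof
  assume h: "((\<lambda>t. indicator (S t) x :: real) has_sum 1) T"
  have "\<exists>t\<in>T. x \<in> S t"
  proof (rule ccontr)
    assume "\<not> (\<exists>t\<in>T. x \<in> S t)"
    then have "((\<lambda>t. indicator (S t) x :: real) has_sum 0) T" by (intro has_sum_0) auto
    then show False using h has_sum_unique by fastforce
  qed
  moreover have "t = u" if "t \<in> T" "u \<in> T" "x \<in> S t" "x \<in> S u" for t u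
  proof (rule ccontr)
    assume "t \<noteq> u"
    then show False using finite_sum_le_has_sum[OF h, of "{t, u}"] that by simp
  qed
  ultimately show "\<exists>!t. t \<in> T \<and> x \<in> S t" by blast
next
  assume "\<exists>!t. t \<in> T \<and> x \<in> S t"
  then obtain t where t: "t \<in> T" "x \<in> S t" "\<And>u. u \<in> T \<Longrightarrow> x \<in> S u \<Longrightarrow> u = t" by blast
  show "((\<lambda>t. indicator (S t) x :: real) has_sum 1) T"
  proof (rule has_sum_finite_neutralI[of "{t}"])
    show "indicator (S u) x = (0::real)" if "u \<in> T - {t}" for u
      using t(3)[of u] that by (auto simp: indicator_def)
  qed (simp_all add: t(1,2))
qed

lemma is_tile_iff: "is_tile \<Omega> \<longleftrightarrow> (\<exists>T. countable T \<and> (AE x in lebesgue. \<exists>!t. t \<in> T \<and> x - t \<in> \<Omega>))"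
proof -
  have "(indicator \<Omega> (x - t) :: real) = indicator {x. x - t \<in> \<Omega>} x" for x t
    by (simp add: indicator_def)
  then show ?thesis unfolding is_tile_def by (simp only: has_sum_indicator_one_iff mem_Collect_eq)
qed

text \<open>A countable union of hyperplanes is null. This disposes of the points on the boundaries
  of countably many open cubes.\<close>

lemma AE_component_neq:
  fixes j :: "'n::finite"
  assumes "countable C"
  shows "AE x in lebesgue. (x :: real ^ 'n) $ j \<notin> C"
proof -
  have "AE x in lebesgue. (x :: real ^ 'n) $ j \<noteq> c" for c
  proof (rule AE_I')
    have "negligible {x :: real ^ 'n. axis j 1 \<bullet> x = c}"
      by (intro negligible_hyperplane) (simp add: axis_eq_0_iff)
    also have "{x :: real ^ 'n. axis j 1 \<bullet> x = c} = {x. x $ j = c}" by (simp add: inner_axis')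
    finally show "{x :: real ^ 'n. x $ j = c} \<in> null_sets lebesgue" by (simp add: negligible_iff_null_sets)
  qed auto
  then have "AE x in lebesgue. \<forall>c\<in>C. (x :: real ^ 'n) $ j \<noteq> c"
    by (subst AE_ball_countable[OF assms]) auto
  then show ?thesis by (rule eventually_mono) auto
qed

text \<open>With \<open>a\<^sub>i = n\<close>, the lattice generated by \<open>a / n\<close> and the unit vectors other than the
  \<open>i\<close>-th tiles with the cube.\<close>

lemma grid_set_imp_is_tile:
  fixes a :: "real ^ 'n"
  assumes "a \<in> grid_set"
  shows "is_tile ({0, a} + unit_cube)"
proof -
  obtain i n where n: "a $ i = of_int n" "n \<noteq> 0"
    using assms by (auto simp: grid_set_def elim!: Ints_cases)
  define v where "v j = a $ j / of_int n" for j
  define L :: "int \<Rightarrow> (real ^ 'n) set" where "L s = {u. u $ i = of_int s \<and> (\<forall>j. j \<noteq> i \<longrightarrow> u $ j - of_int s * v j \<in> \<int>)}" for s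
  \<comment> \<open>\<open>L s\<close> is the layer of the lattice at height \<open>s\<close> in
    direction \<open>i\<close>, and translation by \<open>a\<close> takes layer \<open>s\<close> to
    layer \<open>s + n\<close>. Keeping alternate blocks of \<open>|n|\<close> consecutive layers
    therefore makes \<open>T\<close> and \<open>T + a\<close> partition the lattice. Division with
    \<open>div\<close> treats both signs of \<open>n\<close> alike.\<close>
  define T where "T = (\<Union>s\<in>{s. even (s div n)}. L s)"
  have "countable (L s)" for s
  proof -
    have "L s \<subseteq> range (\<lambda>k::int^'n. \<chi> j. if j = i then of_int s else of_int s * v j + of_int (k $ j))"
    proof
      fix u assume u: "u \<in> L s"
      have "u = (\<chi> j. if j = i then of_int s else of_int s * v j + of_int ((\<chi> j. \<lfloor>u $ j - of_int s * v j\<rfloor>) $ j))"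
        using u by (auto simp: L_def vec_eq_iff elim!: Ints_cases)
      then show "u \<in> range (\<lambda>k::int^'n. \<chi> j. if j = i then of_int s else of_int s * v j + of_int (k $ j))"
        by (rule range_eqI)
    qed
    then show ?thesis by (rule countable_subset) auto
  qed
  then have "countable T" unfolding T_def by auto
  moreover have "AE x in lebesgue. \<exists>!t. t \<in> T \<and> x - t \<in> {0, a} + unit_cube"
  proof -
    have "AE x in lebesgue. \<forall>j. (x :: real^'n) $ j \<notin> (\<lambda>(m::int, k::int). of_int m * v j + of_int k) ` UNIV" (is "AE x in _. ?G x")
      by (simp only: AE_all_countable) (intro allI AE_component_neq countable_image countableI_type)
    moreover have "AE x in lebesgue. (x :: real^'n) $ i \<notin> \<int>"
      by (intro AE_component_neq) (auto simp: Ints_def)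
    ultimately show ?thesis
    proof eventually_elim
      fix x :: "real ^ 'n"
      assume x: "?G x" "x $ i \<notin> \<int>"
      define m where "m = \<lfloor>x $ i\<rfloor>"
      \<comment> \<open>The lattice point whose cube contains \<open>x\<close>: the height fixes the
        layer \<open>m\<close>, and the other coordinates are rounded down relative to the shear of
        that layer.\<close>
      define l where "l = (\<chi> j. if j = i then of_int m else of_int m * v j + of_int \<lfloor>x $ j - of_int m * v j\<rfloor>)"
      have lL: "l \<in> L m" by (simp add: L_def l_def)
      have fl: "of_int \<lfloor>y\<rfloor> < y" if "y \<notin> \<int>" for y :: real
        using that of_int_floor_le[of y] by (metis Ints_of_int order_le_less)
      have xl: "x - l \<in> unit_cube"
      proof -
        have "0 < x $ j - l $ j \<and> x $ j - l $ j < 1" for j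
        proof (cases "j = i")
          case True
          have "of_int m < x $ i" unfolding m_def using x(2) by (rule fl)
          moreover have "x $ i < of_int m + 1" unfolding m_def by linarith
          ultimately show ?thesis by (simp add: l_def True)
        next
          case False
          have "x $ j - of_int m * v j \<notin> \<int>"
          proof
            assume "x $ j - of_int m * v j \<in> \<int>"
            then obtain k where "x $ j - of_int m * v j = of_int k" by (auto elim: Ints_cases)
            then have "x $ j = (\<lambda>(m::int, k::int). of_int m * v j + of_int k) (m, k)" by simp
            then show False using x(1) by blast
          qed
          from fl[OF this] False show ?thesis by (simp add: l_def) linarith
        qed
        then show ?thesis by (simp add: unit_cube_def)
      qed
      have uniq: "u = l \<and> s = m" if u: "u \<in> L s" "x - u \<in> unit_cube" for u s
      proof -
        have c: "0 < x $ j - u $ j" "x $ j - u $ j < 1" for j using u(2) by (auto simp: unit_cube_def)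
        have "s = m" using c[of i] u(1) unfolding m_def L_def by (simp add: floor_eq_iff[symmetric] eq_commute[of s]) linarith
        moreover have "u $ j = l $ j" for j
        proof (cases "j = i")
          case False
          then obtain k where k: "u $ j - of_int m * v j = of_int k"
            using u(1) \<open>s = m\<close> by (auto simp: L_def elim: Ints_cases)
          then have "\<lfloor>x $ j - of_int m * v j\<rfloor> = k" using c[of j] by (intro floor_unique) linarith+
          then show ?thesis using k False by (simp add: l_def)
        qed (use u(1) \<open>s = m\<close> in \<open>auto simp: L_def l_def\<close>)
        ultimately show ?thesis by (simp add: vec_eq_iff)
      qed
      \<comment> \<open>By the choice of \<open>v\<close>, the vector \<open>a\<close> is
        \<open>n\<close> times the sheared step from one layer to the next.\<close>
      have La: "t + a \<in> L (s + n) \<longleftrightarrow> t \<in> L s" for t s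
      proof -
        have "(t + a) $ j - of_int (s + n) * v j = t $ j - of_int s * v j" for j
          using n(2) by (simp add: v_def add_divide_distrib distrib_right)
        moreover have "(t + a) $ i = of_int (s + n) \<longleftrightarrow> t $ i = of_int s" using n(1) by simp
        ultimately show ?thesis unfolding L_def by (simp only: mem_Collect_eq)
      qed
      have ev: "even ((s + n) div n) \<longleftrightarrow> odd (s div n)" for s using n(2) by simp
      show "\<exists>!t. t \<in> T \<and> x - t \<in> {0, a} + unit_cube"
      proof (intro ex1I)
        \<comment> \<open>If the layer of \<open>l\<close> was kept, the cube at \<open>l\<close> is
          the first copy in its tile. Otherwise layer \<open>m - n\<close> was kept, and the cube at
          \<open>l\<close> is the second copy in the tile of \<open>l - a\<close>.\<close>
        show "(if even (m div n) then l else l - a) \<in> T \<and> x - (if even (m div n) then l else l - a) \<in> {0, a} + unit_cube"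
        proof (cases "even (m div n)")
          case True
          then show ?thesis using lL xl by (auto simp: T_def two_cubes_mem)
        next
          case False
          then have "even ((m - n) div n)" using ev[of "m - n"] by simp
          moreover have "l - a \<in> L (m - n)" using lL La[of "l - a" "m - n"] by simp
          moreover have "x - (l - a) - a \<in> unit_cube" using xl by simp
          ultimately show ?thesis using False by (auto simp only: T_def two_cubes_mem if_False)
        qed
      next
        fix t assume t: "t \<in> T \<and> x - t \<in> {0, a} + unit_cube"
        then obtain s where s: "even (s div n)" "t \<in> L s" by (auto simp: T_def)
        from t have "x - t \<in> unit_cube \<or> x - (t + a) \<in> unit_cube" by (simp add: two_cubes_mem diff_diff_eq)
        then show "t = (if even (m div n) then l else l - a)"
        proof
          assume "x - t \<in> unit_cube"
          then show ?thesis using uniq[of t s] s by simp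
        next
          assume "x - (t + a) \<in> unit_cube"
          then have "t + a = l" "s + n = m" using uniq[of "t + a" "s + n"] s La[of t s] by simp_all
          then show ?thesis using ev[of s] s by (metis add_diff_cancel)
        qed
      qed
    qed
  qed
  ultimately show ?thesis by (auto simp: is_tile_iff)
qed

text \<open>After a translation one tile of the tiling is \<Omega> itself; counting measure on the
  remaining translations then covers exactly the complement. Local finiteness holds because tiles
  containing translates of a fixed ball cannot accumulate.\<close>

lemma is_tile_imp_is_weak_tile:
  fixes \<Omega> :: "'a::euclidean_space set"
  assumes "open \<Omega>" "\<Omega> \<noteq> {}" "is_tile \<Omega>"
  shows "is_weak_tile \<Omega>"
proof -
  obtain T where T: "countable T" and ae: "AE x in lebesgue. \<exists>!t. t \<in> T \<and> x - t \<in> \<Omega>"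
    using assms(3) unfolding is_tile_iff by blast
  obtain t0 where t0: "t0 \<in> T"
    using AE_lebesgue_ex_open[OF ae open_UNIV UNIV_not_empty] by blast
  define S where "S = {t. t + t0 \<in> T} - {0}"
  define \<mu> where "\<mu> = distr (count_space S) borel id"
  have sets: "sets \<mu> = sets borel" by (simp add: \<mu>_def)
  have em: "emeasure \<mu> B = emeasure (count_space S) (B \<inter> S)" if "B \<in> sets borel" for B
    unfolding \<mu>_def using that by (subst emeasure_distr) auto
  obtain c r where r: "r > 0" "ball c r \<subseteq> \<Omega>" using assms open_contains_ball by blast
  \<comment> \<open>For \<open>t\<close> and \<open>u\<close> near \<open>x\<close>, every y near
    \<open>x + c\<close> has \<open>y - t\<close> and \<open>y - u\<close> both in the ball inside
    \<Omega>. Some such y is covered only once, which forces \<open>t = u\<close>.\<close>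
  have loc: "t = u" if "t \<in> T" "u \<in> T" "t \<in> ball x (r/2)" "u \<in> ball x (r/2)" for t u x
  proof -
    obtain y where y: "y \<in> ball (x + c) (r/2)" "\<exists>!t. t \<in> T \<and> y - t \<in> \<Omega>"
    proof -
      have "ball (x + c) (r/2) \<noteq> {}" using r by simp
      from AE_lebesgue_ex_open[OF ae open_ball this] show ?thesis using that by blast
    qed
    have "y - w \<in> \<Omega>" if "w \<in> ball x (r/2)" for w
    proof -
      have "dist c (y - w) \<le> dist (x + c) y + dist x w"
      proof -
        have "c - (y - w) = (x + c - y) + (w - x)" by simp
        then show ?thesis unfolding dist_norm norm_minus_commute[of x w] by (metis norm_triangle_ineq)
      qed
      then show ?thesis using r(2) y(1) that by auto
    qed
    then show ?thesis using y(2) that by blast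
  qed
  have "locally_finite_measure \<mu>"
    unfolding locally_finite_measure_def
  proof
    fix x :: 'a
    let ?U = "ball x (r/2)"
    have "t = u" if "t \<in> ?U \<inter> S" "u \<in> ?U \<inter> S" for t u
    proof -
      have "w + t0 \<in> T \<and> w + t0 \<in> ball (x + t0) (r/2)" if "w \<in> ?U \<inter> S" for w
        using that by (simp add: S_def dist_norm)
      then show ?thesis using loc[of "t + t0" "u + t0" "x + t0"] that by simp
    qed
    then have "?U \<inter> S = {} \<or> (\<exists>t. ?U \<inter> S = {t})" by blast
    then have "finite (?U \<inter> S)" by (metis finite.emptyI finite_insert)
    then have "emeasure \<mu> ?U < \<infinity>" by (simp add: em of_nat_less_top)
    then show "\<exists>U. open U \<and> x \<in> U \<and> emeasure \<mu> U < \<infinity>" using r by (intro exI[of _ ?U]) auto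
  qed
  moreover have "AE x in lebesgue. (\<integral>\<^sup>+ t. indicator \<Omega> (x - t) \<partial>\<mu>) = indicator (- \<Omega>) x"
  proof -
    obtain N where N: "\<And>x. x \<in> space lborel - N \<Longrightarrow> \<exists>!t. t \<in> T \<and> x - t \<in> \<Omega>" "N \<in> null_sets lborel"
      by (rule AE_E3[OF ae[unfolded AE_completion_iff]]) (rule that, assumption+)
    \<comment> \<open>The exceptional null set has to be moved along with the tiling.\<close>
    have "AE x in lborel. x - (- t0) \<notin> N"
      using null_sets_translation[OF N(2), of "- t0"] by (intro AE_I'[of "{x. x - (- t0) \<in> N}"]) auto
    then have "AE x in lebesgue. x - (- t0) \<notin> N" by (simp add: AE_completion_iff)
    then show ?thesis
    proof (rule eventually_mono)
      fix x assume "x - (- t0) \<notin> N"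
      then have "\<exists>!t. t \<in> T \<and> x + t0 - t \<in> \<Omega>" using N(1)[of "x + t0"] by simp
      then obtain t where t: "t \<in> T" "x + t0 - t \<in> \<Omega>" "\<And>u. u \<in> T \<Longrightarrow> x + t0 - u \<in> \<Omega> \<Longrightarrow> u = t" by blast
      have op: "open {t. x - t \<in> \<Omega>}"
        using open_vimage[OF assms(1), of "\<lambda>t. x - t"] by (simp add: vimage_def continuous_intros)
      have "(\<integral>\<^sup>+ t. indicator \<Omega> (x - t) \<partial>\<mu>) = (\<integral>\<^sup>+ t. indicator {t. x - t \<in> \<Omega>} t \<partial>\<mu>)"
        by (intro nn_integral_cong) (auto simp: indicator_def)
      also have "\<dots> = emeasure (count_space S) ({t. x - t \<in> \<Omega>} \<inter> S)"
        using op sets by (subst nn_integral_indicator) (auto simp: em)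
      also have "{t. x - t \<in> \<Omega>} \<inter> S = (if x \<in> \<Omega> then {} else {t - t0})"
      proof -
        have S_iff: "s \<in> S \<longleftrightarrow> s + t0 \<in> T \<and> s + t0 \<noteq> t0" for s by (simp add: S_def)
        have x_iff: "x - s \<in> \<Omega> \<and> s \<in> S \<longleftrightarrow> s = t - t0 \<and> t \<noteq> t0" for s
          using t(1,2) t(3)[of "s + t0"] by (auto simp: S_iff algebra_simps)
        \<comment> \<open>The tile of \<open>t0\<close> covers \<open>x + t0\<close> exactly when
          \<open>x\<close> is in \<Omega>; deleting the origin from the translations uncovers
          precisely these points.\<close>
        have "x \<in> \<Omega> \<longleftrightarrow> t = t0" using t(2) t(3)[of t0] t0 by auto
        then show ?thesis using x_iff by auto
      qed
      also have "emeasure (count_space S) \<dots> = indicator (- \<Omega>) x"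
      proof (cases "x \<in> \<Omega>")
        case False
        then have "t \<noteq> t0" using t(2) by auto
        then have "t - t0 \<in> S" using t(1) by (simp add: S_def)
        then show ?thesis using False by simp
      qed simp
      finally show "(\<integral>\<^sup>+ t. indicator \<Omega> (x - t) \<partial>\<mu>) = indicator (- \<Omega>) x" .
    qed
  qed
  ultimately show ?thesis unfolding is_weak_tile_def using sets by blast
qed

section \<open>Fourier transforms of boxes\<close>

lemma expo_add_left: "expo (\<xi> + \<eta>) x = expo \<xi> x * expo \<eta> x"
  by (simp add: expo_def inner_add_left distrib_left exp_add)

lemma expo_add_right: "expo \<xi> (x + y) = expo \<xi> x * expo \<xi> y"
  by (simp add: expo_def inner_add_right distrib_left exp_add)

lemma expo_zero_left [simp]: "expo 0 x = 1"
  by (simp add: expo_def)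

lemma norm_expo [simp]: "norm (expo \<xi> x) = 1"
  by (simp add: expo_def norm_exp_eq_Re)

lemma expo_nonzero [simp]: "expo \<xi> x \<noteq> 0"
  by (simp add: expo_def)

lemma expo_minus_left: "expo (- \<xi>) x = cnj (expo \<xi> x)"
  by (simp add: expo_def exp_cnj)

lemma expo_minus_right: "expo \<xi> (- x) = cnj (expo \<xi> x)"
  by (simp add: expo_def exp_cnj)

lemma expo_diff_left: "expo (\<xi> - \<eta>) x = expo \<xi> x * cnj (expo \<eta> x)"
  using expo_add_left[of \<xi> "- \<eta>" x] by (simp add: expo_minus_left)

lemma continuous_on_expo [continuous_intros]: "continuous_on S (expo \<xi>)"
  unfolding expo_def by (intro continuous_intros)

lemma borel_measurable_expo [measurable]: "expo \<xi> \<in> borel_measurable borel"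
  by (intro borel_measurable_continuous_onI continuous_intros)

lemma expo_eq_1_iff: "expo \<xi> x = 1 \<longleftrightarrow> \<xi> \<bullet> x \<in> \<int>"
proof -
  have "expo \<xi> x = 1 \<longleftrightarrow> (\<exists>n::int. 2 * pi * (\<xi> \<bullet> x) = of_int (2 * n) * pi)"
    by (simp add: expo_def exp_eq_1)
  also have "\<dots> \<longleftrightarrow> (\<exists>n::int. \<xi> \<bullet> x = of_int n)"
    by (simp add: mult.commute)
  finally show ?thesis by (auto simp: Ints_def)
qed

lemma expo_vec: "expo \<xi> x = (\<Prod>i\<in>UNIV. expo (\<xi> $ i) (x $ i))" for \<xi> :: "real ^ 'n"
  by (simp add: expo_def inner_vec_def exp_sum[symmetric] sum_distrib_left)

text \<open>Fubini for a product of functions of single coordinates. \<open>lborel\<close> is the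
  image of a product measure indexed by \<open>Basis\<close>, so the factors are reindexed from
  coordinates to basis vectors through \<open>ix\<close>.\<close>

lemma integral_prod_vec:
  fixes f :: "'n::finite \<Rightarrow> real \<Rightarrow> complex"
  assumes f: "\<And>i. integrable lborel (f i)"
  shows "(\<integral>x. (\<Prod>i\<in>UNIV. f i (x $ i)) \<partial>(lborel :: (real ^ 'n) measure)) = (\<Prod>i\<in>UNIV. integral\<^sup>L lborel (f i))"
proof -
  have [measurable]: "f i \<in> borel_measurable borel" for i
    using borel_measurable_integrable[OF f[of i]] by simp
  define ix :: "real ^ 'n \<Rightarrow> 'n" where "ix = inv (\<lambda>i. axis i 1)"
  have inj: "inj (\<lambda>i. axis i 1 :: real ^ 'n)" by (auto simp: inj_on_def axis_eq_axis)
  have ix: "ix (axis i 1) = i" for i unfolding ix_def using inj by (rule inv_f_f)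
  have B: "(Basis :: (real ^ 'n) set) = range (\<lambda>i. axis i 1)" by (auto simp: Basis_vec_def)
  interpret product_sigma_finite "\<lambda>b::real^'n. lborel :: real measure" ..
  have "(\<integral>x. (\<Prod>i\<in>UNIV. f i (x $ i)) \<partial>(lborel :: (real ^ 'n) measure)) =
    (\<integral>y. (\<Prod>i\<in>UNIV. f i ((\<Sum>b\<in>Basis. y b *\<^sub>R b :: real ^ 'n) $ i)) \<partial>(\<Pi>\<^sub>M b\<in>Basis. lborel))"
    by (subst lborel_eq) (intro integral_distr, measurable)
  also have "\<dots> = (\<integral>y. (\<Prod>b\<in>Basis. f (ix b) (y b)) \<partial>(\<Pi>\<^sub>M b\<in>Basis. lborel))"
  proof (intro Bochner_Integration.integral_cong refl)
    fix y :: "real ^ 'n \<Rightarrow> real"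
    have c: "(\<Sum>b\<in>Basis. y b *\<^sub>R b :: real ^ 'n) $ i = y (axis i 1)" for i
    proof -
      have "(\<Sum>b\<in>Basis. y b *\<^sub>R b :: real ^ 'n) $ i = (\<Sum>b\<in>Basis. y b *\<^sub>R b) \<bullet> axis i 1"
        by (simp add: inner_axis)
      also have "\<dots> = y (axis i 1)" by (rule inner_sum_left_Basis) (auto simp: B)
      finally show ?thesis .
    qed
    show "(\<Prod>i\<in>UNIV. f i ((\<Sum>b\<in>Basis. y b *\<^sub>R b :: real ^ 'n) $ i)) = (\<Prod>b\<in>Basis. f (ix b) (y b))"
      unfolding c unfolding B by (subst prod.reindex[OF inj]) (simp add: ix)
  qed
  also have "\<dots> = (\<Prod>b\<in>Basis. integral\<^sup>L lborel (f (ix b)))"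
    by (rule product_integral_prod) (auto intro: f)
  also have "\<dots> = (\<Prod>i\<in>UNIV. integral\<^sup>L lborel (f i))"
    unfolding B by (subst prod.reindex[OF inj]) (simp add: ix)
  finally show ?thesis .
qed

text \<open>The Fourier transform of the indicator with a positive sign in the exponent, so that the
  inner product of \<open>expo \<xi>\<close> and \<open>expo \<eta>\<close> is its value at
  \<open>\<xi> - \<eta>\<close>.\<close>

definition fourier_set :: "'a::euclidean_space set \<Rightarrow> 'a \<Rightarrow> complex" where
  "fourier_set S \<xi> = (\<integral>x. indicator S x *\<^sub>R expo \<xi> x \<partial>lborel)"

lemma integrable_indicator_expo:
  assumes "S \<in> sets borel" "bounded S"
  shows "integrable lborel (\<lambda>x. indicator S x *\<^sub>R expo \<xi> x)"
  by (rule Bochner_Integration.integrable_bound[of _ "indicator S :: _ \<Rightarrow> real"])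
    (use assms emeasure_bounded_finite[of S] in \<open>auto simp: indicator_def\<close>)

lemma fourier_set_product:
  fixes S :: "'n::finite \<Rightarrow> real set"
  assumes S: "\<And>i. S i \<in> sets borel" "\<And>i. bounded (S i)"
  shows "fourier_set {x :: real ^ 'n. \<forall>i. x $ i \<in> S i} \<xi> = (\<Prod>i\<in>UNIV. fourier_set (S i) (\<xi> $ i))"
proof -
  have "indicator {x :: real ^ 'n. \<forall>i. x $ i \<in> S i} x *\<^sub>R expo \<xi> x =
      (\<Prod>i\<in>UNIV. indicator (S i) (x $ i) *\<^sub>R expo (\<xi> $ i) (x $ i))" for x
  proof (cases "\<forall>i. x $ i \<in> S i")
    case True
    then show ?thesis by (simp add: expo_vec)
  next
    case False
    then obtain i where "x $ i \<notin> S i" by blast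
    then have "(\<Prod>i\<in>UNIV. indicator (S i) (x $ i) *\<^sub>R expo (\<xi> $ i) (x $ i)) = 0"
      by (intro prod_zero bexI[of _ i]) auto
    then show ?thesis using False by simp
  qed
  then show ?thesis unfolding fourier_set_def
    using S by (simp only:) (intro integral_prod_vec integrable_indicator_expo)
qed

lemma fourier_set_Icc:
  assumes "u \<le> v"
  shows "fourier_set {u..v} \<xi> = (if \<xi> = 0 then of_real (v - u) else (expo \<xi> v - expo \<xi> u) / (2 * of_real pi * \<i> * of_real \<xi>))"
proof (cases "\<xi> = 0")
  case True
  then show ?thesis using assms unfolding fourier_set_def by (simp add: scaleR_conv_of_real del: of_real_diff)
next
  case False
  define c where "c = 2 * of_real pi * \<i> * complex_of_real \<xi>"
  have c: "c \<noteq> 0" using False by (simp add: c_def)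
  have e: "expo \<xi> x = exp (c * of_real x)" for x by (simp add: expo_def c_def mult.assoc)
  have "fourier_set {u..v} \<xi> = expo \<xi> v / c - expo \<xi> u / c"
    unfolding fourier_set_def
  proof (rule integral_FTC_atLeastAtMost[OF assms])
    show "((\<lambda>x. expo \<xi> x / c) has_vector_derivative expo \<xi> x) (at x within {u..v})" for x
      unfolding e using c
      by (auto intro!: derivative_eq_intros has_vector_derivative_real_field simp: field_simps)
  qed (intro continuous_intros)
  then show ?thesis using False by (simp add: c_def diff_divide_distrib)
qed

lemma fourier_set_cong_AE:
  assumes "AE x in lborel. x \<in> S \<longleftrightarrow> x \<in> T" "S \<in> sets borel" "T \<in> sets borel"
  shows "fourier_set S \<xi> = fourier_set T \<xi>"
  unfolding fourier_set_def
  by (rule integral_cong_AE) (use assms in \<open>auto elim!: eventually_mono simp: indicator_def\<close>)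

lemma fourier_set_Ico: "u \<le> v \<Longrightarrow> fourier_set {u..<v} \<xi> = fourier_set {u..v::real} \<xi>"
  by (rule fourier_set_cong_AE) (auto intro!: eventually_mono[OF AE_lborel_singleton[of v]])

lemma fourier_set_Ioo: "u \<le> v \<Longrightarrow> fourier_set {u<..<v} \<xi> = fourier_set {u..v::real} \<xi>"
  by (rule fourier_set_cong_AE)
    (auto intro!: eventually_mono[OF eventually_conj[OF AE_lborel_singleton[of v] AE_lborel_singleton[of u]]])

lemma expo_real_add_int:
  fixes \<xi> y :: real
  assumes "\<xi> \<in> \<int>" "k \<in> \<int>"
  shows "expo \<xi> (y + k) = expo \<xi> y"
proof -
  have "expo \<xi> k = 1" using assms by (simp add: expo_eq_1_iff)
  then show ?thesis by (simp add: expo_add_right)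
qed

lemma fourier_set_unit_interval_eq_0_iff:
  "fourier_set {0<..<1} \<xi> = 0 \<longleftrightarrow> (\<xi>::real) \<in> \<int> - {0}"
  using expo_eq_1_iff[of \<xi> 1] by (simp add: fourier_set_Ioo fourier_set_Icc expo_def)

text \<open>At an integer frequency the exponential has period 1, so every fundamental domain of the
  integers yields the same integral as the unit interval.\<close>

lemma fourier_set_split_interval:
  assumes "\<xi> \<in> \<int>"
  shows "fourier_set (split_interval s) \<xi> = (if \<xi> = 0 then 1 else 0)"
proof -
  let ?f = "frac s" and ?k = "of_int \<lfloor>s\<rfloor> :: real"
  have f: "0 \<le> ?f" "?f < 1" by (auto simp: frac_lt_1)
  have s: "s = ?f + ?k" by (simp add: frac_def)
  have le: "s \<le> 1 + ?k" using f s by linarith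
  have "fourier_set (split_interval s) \<xi> = fourier_set {0..<?f} \<xi> + fourier_set {s..<1 + ?k} \<xi>"
  proof -
    have "indicator (split_interval s) x *\<^sub>R expo \<xi> x = indicator {0..<?f} x *\<^sub>R expo \<xi> x + indicator {s..<1 + ?k} x *\<^sub>R expo \<xi> x" for x
      using split_interval_disjoint[of x s] unfolding split_interval_def by (cases "x \<in> {0..<?f}") (simp_all add: indicator_def del: atLeastLessThan_iff)
    then show ?thesis unfolding fourier_set_def
      by (simp only:) (intro Bochner_Integration.integral_add integrable_indicator_expo, auto)
  qed
  also have "\<dots> = (if \<xi> = 0 then 1 else 0)"
  proof (cases "\<xi> = 0")
    case True
    have "complex_of_real (?f - 0) + complex_of_real (1 + ?k - s) = 1"
    proof -
      have "(?f - 0) + (1 + ?k - s) = 1" by (simp add: frac_def)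
      then show ?thesis by (metis of_real_1 of_real_add)
    qed
    then show ?thesis using f le True by (simp add: fourier_set_Ico fourier_set_Icc)
  next
    case False
    \<comment> \<open>Up to integers the endpoints of the two pieces are 0, \<open>frac s\<close>,
      \<open>frac s\<close> and 0, so the values of the primitive cancel in pairs.\<close>
    have "expo \<xi> (1 + ?k) = expo \<xi> (0 + (1 + ?k))" by simp
    also have "\<dots> = 1" using assms by (subst expo_real_add_int) (auto simp: expo_def)
    finally have 1: "expo \<xi> (1 + ?k) = 1" .
    have 2: "expo \<xi> s = expo \<xi> ?f" by (subst s, rule expo_real_add_int) (use assms in auto)
    show ?thesis using f le False 1 2
      by (simp add: fourier_set_Ico fourier_set_Icc add_divide_distrib[symmetric]) (simp add: expo_def)
  qed
  finally show ?thesis .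
qed

lemma bounded_split_interval: "bounded (split_interval s)"
  by (auto simp: split_interval_def)

lemma unit_cube_product: "unit_cube = {x. \<forall>i. x $ i \<in> {0<..<1}}"
  by (auto simp: unit_cube_def)

text \<open>The transform is a product over the coordinates, and a factor vanishes exactly at
  nonzero integers. Thus \<open>grid_set\<close> is the zero set of the transform of the
  cube.\<close>

lemma fourier_set_unit_cube_eq_0_iff: "fourier_set unit_cube \<xi> = 0 \<longleftrightarrow> \<xi> \<in> grid_set"
  unfolding unit_cube_product
  by (subst fourier_set_product) (auto simp: fourier_set_unit_interval_eq_0_iff grid_set_def)

lemma fourier_set_unit_cube_0: "fourier_set unit_cube 0 = 1"
  unfolding unit_cube_product
  by (subst fourier_set_product) (auto simp: fourier_set_Ioo fourier_set_Icc)

lemma fourier_set_split_box_0: "fourier_set {x. \<forall>i. x $ i \<in> split_interval (a $ i)} 0 = 1"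
  by (subst fourier_set_product) (auto simp: fourier_set_split_interval bounded_split_interval)

text \<open>One coordinate that is a nonzero integer kills its factor, whatever the other factors
  are. This inclusion of zero sets carries orthogonality from the cube to the exchanged box.\<close>

lemma fourier_set_split_box_grid:
  assumes "\<xi> \<in> grid_set"
  shows "fourier_set {x. \<forall>i. x $ i \<in> split_interval (a $ i)} \<xi> = 0"
proof -
  obtain i where i: "\<xi> $ i \<in> \<int> - {0}" using assms by (auto simp: grid_set_def)
  then have "fourier_set (split_interval (a $ i)) (\<xi> $ i) = 0" by (simp add: fourier_set_split_interval)
  then show ?thesis
    by (subst fourier_set_product) (auto simp: bounded_split_interval)
qed

lemma fourier_set_translate:
  assumes "S \<in> sets borel"
  shows "fourier_set {x. x - a \<in> S} \<xi> = expo \<xi> a * fourier_set S \<xi>"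
proof -
  have "fourier_set {x. x - a \<in> S} \<xi> = (\<integral>x. indicator S (x - a) *\<^sub>R expo \<xi> x \<partial>lborel)"
    by (simp add: fourier_set_def indicator_def)
  also have "\<dots> = (\<integral>x. indicator S (a + x - a) *\<^sub>R expo \<xi> (a + x) \<partial>lborel)"
    using assms by (subst lborel_distr_plus[symmetric, of a], subst integral_distr) auto
  also have "\<dots> = expo \<xi> a * fourier_set S \<xi>"
    by (simp add: fourier_set_def expo_add_right mult_scaleR_right[symmetric] del: mult_scaleR_right)
  finally show ?thesis .
qed

lemma two_cubes_eq_Un: "{0, a} + (S :: 'a::ab_group_add set) = S \<union> {x. x - a \<in> S}"
  using two_cubes_mem[of _ a S] by blast

text \<open>\<Omega> is the convolution of the cube with the point masses at 0 and \<open>a\<close>.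
  Orthogonality of two exponentials thus comes either from the mask factor
  \<open>1 + expo \<xi> a\<close> or from \<open>grid_set\<close>.\<close>

lemma fourier_set_two_cubes:
  fixes a :: "real ^ 'n"
  assumes disj: "unit_cube \<inter> (\<lambda>x. x + a) ` unit_cube = {}"
  shows "fourier_set ({0, a} + unit_cube) \<xi> = (1 + expo \<xi> a) * fourier_set unit_cube \<xi>"
proof -
  let ?Q = "unit_cube :: (real ^ 'n) set"
  have Q[measurable]: "?Q \<in> sets borel" by (rule borel_open[OF open_unit_cube])
  have bd: "bounded ?Q" by (simp add: unit_cube_eq_box)
  have Qa: "{x. x - a \<in> ?Q} = (+) a ` ?Q" by (auto simp: image_iff) (metis diff_add_cancel add.commute)
  have [measurable]: "{x. x - a \<in> ?Q} \<in> sets borel"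
    unfolding Qa by (rule borel_open[OF open_translation[OF open_unit_cube]])
  have bda: "bounded {x. x - a \<in> ?Q}" unfolding Qa using bd by (rule bounded_translation)
  have "indicator ({0, a} + ?Q) x *\<^sub>R expo \<xi> x = indicator ?Q x *\<^sub>R expo \<xi> x + indicator {x. x - a \<in> ?Q} x *\<^sub>R expo \<xi> x" for x
    using two_cubes_disjoint[OF disj, of x] by (auto simp: two_cubes_mem indicator_def)
  then have "fourier_set ({0, a} + ?Q) \<xi> = fourier_set ?Q \<xi> + fourier_set {x. x - a \<in> ?Q} \<xi>"
    unfolding fourier_set_def using bd bda
    by (simp only:) (intro Bochner_Integration.integral_add integrable_indicator_expo, auto)
  then show ?thesis by (simp add: fourier_set_translate distrib_right)
qed

lemma borel_two_cubes: "{0, a} + unit_cube \<in> sets borel" and open_two_cubes: "open ({0, a} + unit_cube)"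
  and bounded_two_cubes: "bounded ({0, a} + unit_cube)"
proof -
  have Qa: "{x. x - a \<in> unit_cube} = (+) a ` unit_cube" by (auto simp: image_iff) (metis diff_add_cancel add.commute)
  show o: "open ({0, a} + unit_cube)"
    unfolding two_cubes_eq_Un Qa by (intro open_Un open_unit_cube open_translation)
  then show "{0, a} + unit_cube \<in> sets borel" by (rule borel_open)
  show "bounded ({0, a} + unit_cube)" unfolding two_cubes_eq_Un Qa
    by (simp add: unit_cube_eq_box bounded_translation)
qed

lemma lebesgue_on_integral_borel:
  fixes f :: "'a::euclidean_space \<Rightarrow> 'b::{banach, second_countable_topology}"
  assumes [measurable]: "S \<in> sets borel" "f \<in> borel_measurable borel"
  shows "integral\<^sup>L (lebesgue_on S) f = (\<integral>x. indicator S x *\<^sub>R f x \<partial>lborel)"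
  by (subst integral_restrict_space) (auto simp: integral_completion)

lemma L2_inner_expo:
  assumes "S \<in> sets borel"
  shows "L2_inner (lebesgue_on S) (expo \<xi>) (expo \<eta>) = fourier_set S (\<xi> - \<eta>)"
  unfolding L2_inner_def fourier_set_def expo_diff_left[symmetric]
  using assms by (subst lebesgue_on_integral_borel) auto

section \<open>Spectra\<close>

lemma integrable_scaleR_expo:
  fixes w :: "'a::euclidean_space \<Rightarrow> real"
  assumes "integrable lborel w"
  shows "integrable lborel (\<lambda>x. w x *\<^sub>R expo \<xi> x)"
  by (rule Bochner_Integration.integrable_bound[OF assms])
    (use borel_measurable_integrable[OF assms] in \<open>auto intro!: borel_measurable_scaleR\<close>)

text \<open>The integral \<open>?Z\<close> and the sum \<open>?Y\<close> depend neither on the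
  weight nor on \<open>t\<close>. Two instances with the same \<open>M\<close>, namely \<kappa> = t
  = 1 and \<kappa> = t = 2, have the same combination of them up to the factor 4, so both can be
  eliminated.\<close>

lemma weighted_square_expansion:
  fixes w :: "'a::euclidean_space \<Rightarrow> real" and c :: "'a \<Rightarrow> complex"
  assumes w: "integrable lborel w" and D: "D \<in> sets borel" "bounded D" and wD: "\<And>x. x \<in> D \<Longrightarrow> w x = \<kappa>"
    and F: "finite F"
    and orth: "\<And>\<xi> \<eta>. \<xi> \<in> F \<Longrightarrow> \<eta> \<in> F \<Longrightarrow> \<xi> \<noteq> \<eta> \<Longrightarrow> (\<integral>x. w x *\<^sub>R expo (\<xi> - \<eta>) x \<partial>lborel) = 0"
    and total: "(\<integral>x. w x \<partial>lborel) = M"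
  defines "p \<equiv> \<lambda>x. \<Sum>\<xi>\<in>F. c \<xi> * expo \<xi> x"
  shows "complex_of_real (\<integral>x. w x * (norm (indicator D x - of_real t * p x))\<^sup>2 \<partial>lborel) =
    of_real \<kappa> * of_real (measure lborel D)
    - of_real (t * \<kappa>) * (\<integral>x. indicator D x *\<^sub>R (p x + cnj (p x)) \<partial>lborel)
    + of_real (t\<^sup>2 * M) * (\<Sum>\<xi>\<in>F. c \<xi> * cnj (c \<xi>))"
    (is "_ = of_real \<kappa> * of_real ?m - of_real (t * \<kappa>) * ?Z + of_real (t\<^sup>2 * M) * ?Y")
proof -
  have finD: "emeasure lborel D < \<infinity>" using D(2) by (rule emeasure_bounded_finite)
  have H1: "has_bochner_integral lborel (\<lambda>x. complex_of_real (indicator D x)) (of_real ?m)"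
    using D finD by (intro has_bochner_integral_of_real has_bochner_integral_real_indicator) auto
  have ip: "integrable lborel (\<lambda>x. indicator D x *\<^sub>R p x)"
    unfolding p_def scaleR_sum_right using D
    by (simp only: mult_scaleR_right[symmetric])
      (intro Bochner_Integration.integrable_sum integrable_mult_right integrable_indicator_expo)
  have H2: "has_bochner_integral lborel (\<lambda>x. indicator D x *\<^sub>R (p x + cnj (p x))) ?Z"
  proof -
    have "integrable lborel (\<lambda>x. indicator D x *\<^sub>R p x + cnj (indicator D x *\<^sub>R p x))"
      by (intro Bochner_Integration.integrable_add ip complex_integrable_cnj[THEN iffD2, OF ip])
    then have "integrable lborel (\<lambda>x. indicator D x *\<^sub>R (p x + cnj (p x)))"
      by (simp add: scaleR_add_right)
    then show ?thesis by (rule has_bochner_integral_integrable)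
  qed
  \<comment> \<open>Orthogonality makes the Gram matrix of the exponentials for \<open>w\<close>
    equal to \<open>M\<close> times the identity.\<close>
  have H3: "has_bochner_integral lborel (\<lambda>x. w x *\<^sub>R expo (\<xi> - \<eta>) x) (if \<xi> = \<eta> then of_real M else 0)"
    if "\<xi> \<in> F" "\<eta> \<in> F" for \<xi> \<eta>
  proof -
    have "(\<integral>x. w x *\<^sub>R expo 0 x \<partial>lborel) = of_real (\<integral>x. w x \<partial>lborel)"
      by (simp add: scaleR_conv_of_real)
    then have "(\<integral>x. w x *\<^sub>R expo (\<xi> - \<eta>) x \<partial>lborel) = (if \<xi> = \<eta> then of_real M else 0)"
      using orth[OF that] total by auto
    then show ?thesis unfolding has_bochner_integral_iff by (intro conjI integrable_scaleR_expo w)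
  qed
  have sq: "p x * cnj (p x) = (\<Sum>\<xi>\<in>F. \<Sum>\<eta>\<in>F. c \<xi> * cnj (c \<eta>) * expo (\<xi> - \<eta>) x)" for x
    unfolding p_def by (simp add: cnj_sum sum_product expo_diff_left ac_simps)
  have H4: "has_bochner_integral lborel (\<lambda>x. \<Sum>\<xi>\<in>F. \<Sum>\<eta>\<in>F. c \<xi> * cnj (c \<eta>) * (w x *\<^sub>R expo (\<xi> - \<eta>) x))
     (\<Sum>\<xi>\<in>F. \<Sum>\<eta>\<in>F. c \<xi> * cnj (c \<eta>) * (if \<xi> = \<eta> then of_real M else 0))"
    by (intro has_bochner_integral_sum has_bochner_integral_mult_right H3)
  have Y: "(\<Sum>\<xi>\<in>F. \<Sum>\<eta>\<in>F. c \<xi> * cnj (c \<eta>) * (if \<xi> = \<eta> then of_real M else 0)) = of_real M * ?Y"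
  proof -
    have "(\<Sum>\<eta>\<in>F. c \<xi> * cnj (c \<eta>) * (if \<xi> = \<eta> then of_real M else 0)) = of_real M * (c \<xi> * cnj (c \<xi>))" if "\<xi> \<in> F" for \<xi>
    proof -
      have "(\<Sum>\<eta>\<in>F. c \<xi> * cnj (c \<eta>) * (if \<xi> = \<eta> then of_real M else 0)) = (\<Sum>\<eta>\<in>F. if \<xi> = \<eta> then of_real M * (c \<xi> * cnj (c \<eta>)) else 0)"
        by (intro sum.cong) auto
      then show ?thesis using F that by simp
    qed
    then show ?thesis by (simp add: sum_distrib_left)
  qed
  have "has_bochner_integral lborel
     (\<lambda>x. of_real \<kappa> * complex_of_real (indicator D x) - of_real (t * \<kappa>) * (indicator D x *\<^sub>R (p x + cnj (p x)))
      + of_real (t\<^sup>2) * (\<Sum>\<xi>\<in>F. \<Sum>\<eta>\<in>F. c \<xi> * cnj (c \<eta>) * (w x *\<^sub>R expo (\<xi> - \<eta>) x)))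
     (of_real \<kappa> * of_real ?m - of_real (t * \<kappa>) * ?Z + of_real (t\<^sup>2) * (of_real M * ?Y))"
    unfolding Y[symmetric]
    by (intro has_bochner_integral_add has_bochner_integral_diff has_bochner_integral_mult_right H1 H2 H4)
  moreover have "of_real \<kappa> * complex_of_real (indicator D x) - of_real (t * \<kappa>) * (indicator D x *\<^sub>R (p x + cnj (p x)))
      + of_real (t\<^sup>2) * (\<Sum>\<xi>\<in>F. \<Sum>\<eta>\<in>F. c \<xi> * cnj (c \<eta>) * (w x *\<^sub>R expo (\<xi> - \<eta>) x))
      = of_real (w x * (norm (indicator D x - of_real t * p x))\<^sup>2)" for x
  proof -
    have 1: "(\<Sum>\<xi>\<in>F. \<Sum>\<eta>\<in>F. c \<xi> * cnj (c \<eta>) * (w x *\<^sub>R expo (\<xi> - \<eta>) x)) = of_real (w x) * (p x * cnj (p x))"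
      unfolding sq by (simp add: sum_distrib_left scaleR_conv_of_real ac_simps)
    have 2: "of_real (w x * (norm (indicator D x - of_real t * p x))\<^sup>2) =
      of_real (w x) * ((indicator D x - of_real t * p x) * (indicator D x - of_real t * cnj (p x)))"
      by (simp only: of_real_mult complex_norm_square) (simp add: indicator_def)
    \<comment> \<open>Off \<open>D\<close> the indicator removes the constant and cross terms; on
      \<open>D\<close> the weight in them is \<kappa>.\<close>
    show ?thesis unfolding 1 2 using wD[of x]
      by (cases "x \<in> D") (simp_all add: algebra_simps power2_eq_square)
  qed
  ultimately have "has_bochner_integral lborel (\<lambda>x. complex_of_real (w x * (norm (indicator D x - of_real t * p x))\<^sup>2))
     (of_real \<kappa> * of_real ?m - of_real (t * \<kappa>) * ?Z + of_real (t\<^sup>2) * (of_real M * ?Y))"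
    by simp
  from has_bochner_integral_integral_eq[OF this] show ?thesis
    unfolding integral_complex_of_real of_real_mult[of "t\<^sup>2" M] mult.assoc .
qed

text \<open>Both pieces are closed on the left, so membership of 0 and of \<open>a $ i\<close>
  extends to right neighbourhoods. A positive common width exists because there are finitely many
  coordinates.\<close>

lemma small_cube_split_intervals:
  fixes a :: "real ^ 'n"
  assumes "a \<notin> grid_set"
  obtains \<delta> where "0 < \<delta>" "\<delta> \<le> 1"
    "\<And>i y. 0 \<le> y \<Longrightarrow> y < \<delta> \<Longrightarrow> y \<in> split_interval (a $ i) \<and> a $ i + y \<in> split_interval (a $ i)"
proof -
  have "\<exists>d>0. d \<le> 1 \<and> (\<forall>y. 0 \<le> y \<longrightarrow> y < d \<longrightarrow> y \<in> split_interval (a $ i) \<and> a $ i + y \<in> split_interval (a $ i))" for i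
  proof (cases "a $ i = 0")
    case True
    then show ?thesis by (intro exI[of _ 1]) (simp add: split_interval_def)
  next
    case False
    then have "a $ i \<notin> \<int>" using assms by (auto simp: grid_set_def)
    then have f: "0 < frac (a $ i)" "frac (a $ i) < 1" by (auto simp: frac_lt_1)
    have "a $ i = frac (a $ i) + of_int \<lfloor>a $ i\<rfloor>" by (simp add: frac_def)
    \<comment> \<open>The two quantities in the minimum are the lengths of the two pieces, which
      start at 0 and at \<open>a $ i\<close>.\<close>
    with f show ?thesis
      by (intro exI[of _ "min (frac (a $ i)) (1 - frac (a $ i))"]) (auto simp: split_interval_def)
  qed
  then obtain d where d: "\<And>i. 0 < d i" "\<And>i. d i \<le> 1"
    "\<And>i y. 0 \<le> y \<Longrightarrow> y < d i \<Longrightarrow> y \<in> split_interval (a $ i) \<and> a $ i + y \<in> split_interval (a $ i)"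
    by metis
  show ?thesis
  proof (rule that[of "Min (range d)"])
    show "0 < Min (range d)" using d(1) by simp
    show "Min (range d) \<le> 1" using d(2) by (meson Min_le finite order_trans rangeI finite_imageI)
    show "y \<in> split_interval (a $ i) \<and> a $ i + y \<in> split_interval (a $ i)" if "0 \<le> y" "y < Min (range d)" for i y
      using d(3)[of y i] that by simp
  qed
qed

lemma spectral_imp_grid_set:
  fixes a :: "real ^ 'n"
  assumes disj: "unit_cube \<inter> (\<lambda>x. x + a) ` unit_cube = {}"
    and spectral: "is_spectral_set ({0, a} + unit_cube)"
  shows "a \<in> grid_set"
proof (rule ccontr)
  assume a: "a \<notin> grid_set"
  let ?O = "{0, a} + unit_cube" and ?E = "{x. \<forall>i. x $ i \<in> split_interval (a $ i)}"
  from spectral obtain \<Lambda> where B: "L2_orthogonal_basis (lebesgue_on ?O) expo \<Lambda>"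
    unfolding is_spectral_set_def by blast
  obtain \<delta> where \<delta>: "0 < \<delta>" "\<delta> \<le> 1"
    and \<delta>E: "\<And>i y. 0 \<le> y \<Longrightarrow> y < \<delta> \<Longrightarrow> y \<in> split_interval (a $ i) \<and> a $ i + y \<in> split_interval (a $ i)"
    using small_cube_split_intervals[OF a] by blast
  \<comment> \<open>The cube sits on the positive side of 0, since only right neighbourhoods are
    sure to lie in the pieces.\<close>
  define D where "D = box (0::real^'n) (\<chi> i. \<delta>)"
  have Dm: "D \<in> sets borel" "bounded D" by (simp_all add: D_def)
  have DE: "x \<in> ?E" "x + a \<in> ?E" "x \<in> ?O" if "x \<in> D" for x
  proof -
    have x: "0 < x $ i" "x $ i < \<delta>" for i using that by (simp_all add: D_def mem_box_cart)
    then show "x \<in> ?E" "x + a \<in> ?E" using \<delta>E[of "x $ i" i for i] by (auto simp: add.commute less_imp_le)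
    have "x $ i < 1" for i using x(2)[of i] \<delta> by linarith
    then show "x \<in> ?O" using x by (auto simp: two_cubes_mem unit_cube_def)
  qed
  define m where "m = measure lborel D"
  have "m > 0"
  proof -
    have "D \<noteq> {}" using \<delta> by (simp add: D_def box_ne_empty Basis_vec_def inner_axis)
    then have "\<not> negligible D" unfolding D_def by (intro open_not_negligible open_box)
    then have "emeasure lborel D \<noteq> 0"
      using Dm(1) by (auto simp: negligible_iff_null_sets null_sets_def)
    then show ?thesis unfolding m_def using emeasure_bounded_finite[OF Dm(2)]
      by (simp add: measure_def enn2real_positive_iff zero_less_iff_neq_zero)
  qed
  have O: "?O \<in> sets borel" "bounded ?O" using borel_two_cubes bounded_two_cubes by auto
  have E: "?E \<in> sets borel" "bounded ?E"
  proof -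
    have "{x \<in> space borel. \<forall>i. x $ i \<in> split_interval (a $ i)} \<in> sets borel" by measurable
    then show "?E \<in> sets borel" by simp
    have "\<forall>i. \<exists>r. \<forall>x\<in>split_interval (a $ i). \<bar>x\<bar> \<le> r"
      using bounded_split_interval by (simp add: bounded_iff)
    then obtain r where r: "\<And>i x. x \<in> split_interval (a $ i) \<Longrightarrow> \<bar>x\<bar> \<le> r i" by metis
    have "?E \<subseteq> cbox (\<chi> i. - r i) (\<chi> i. r i)"
    proof
      fix x assume "x \<in> ?E"
      then have "\<bar>x $ i\<bar> \<le> r i" for i using r by blast
      then show "x \<in> cbox (\<chi> i. - r i) (\<chi> i. r i)" by (simp add: mem_box_cart abs_le_iff minus_le_iff)
    qed
    then show "bounded ?E" by (rule bounded_subset[OF bounded_cbox])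
  qed
  have Ea: "{x. x - - a \<in> ?E} \<in> sets borel" "bounded {x. x - - a \<in> ?E}"
  proof -
    have "(\<lambda>x. x - - a) -` ?E \<inter> space borel \<in> sets borel" by (rule measurable_sets[OF _ E(1)]) simp
    then show "{x. x - - a \<in> ?E} \<in> sets borel" by (simp add: vimage_def)
    have "{x. x - - a \<in> ?E} \<subseteq> (+) (- a) ` ?E" by (auto intro!: image_eqI[of _ _ "x + a" for x])
    then show "bounded {x. x - - a \<in> ?E}" using bounded_translation[OF E(2)] bounded_subset by blast
  qed
  \<comment> \<open>Both weights have total mass 2 and make the exponentials orthogonal, but \<open>w2\<close> is 2 on \<open>D\<close>
    where \<open>w1\<close> is 1.\<close>
  define w1 w2 :: "real ^ 'n \<Rightarrow> real" where "w1 = indicator ?O"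
    and "w2 x = indicator ?E x + indicator {x. x - - a \<in> ?E} x" for x
  have int: "integrable lborel (indicator S :: real ^ 'n \<Rightarrow> real)" if "S \<in> sets borel" "bounded S" for S
    using that emeasure_bounded_finite[OF that(2)] by simp
  have ft1: "(\<integral>x. w1 x *\<^sub>R expo \<xi> x \<partial>lborel) = (1 + expo \<xi> a) * fourier_set unit_cube \<xi>" for \<xi>
    using fourier_set_two_cubes[OF disj, of \<xi>] by (simp add: w1_def fourier_set_def)
  have ft2: "(\<integral>x. w2 x *\<^sub>R expo \<xi> x \<partial>lborel) = (1 + cnj (expo \<xi> a)) * fourier_set ?E \<xi>" for \<xi>
  proof -
    have "(\<integral>x. w2 x *\<^sub>R expo \<xi> x \<partial>lborel) = fourier_set ?E \<xi> + fourier_set {x. x - - a \<in> ?E} \<xi>"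
      unfolding w2_def scaleR_add_left fourier_set_def
      by (intro Bochner_Integration.integral_add integrable_indicator_expo E Ea)
    then show ?thesis unfolding fourier_set_translate[OF E(1)] by (simp add: expo_minus_right distrib_right)
  qed
  have w1: "integrable lborel w1" unfolding w1_def by (intro int O)
  have w2: "integrable lborel w2" unfolding w2_def by (intro Bochner_Integration.integrable_add int E Ea)
  have tot1: "(\<integral>x. w1 x \<partial>lborel) = 2"
  proof -
    have "complex_of_real (\<integral>x. w1 x \<partial>lborel) = 2"
      using ft1[of 0] by (simp add: scaleR_conv_of_real fourier_set_unit_cube_0)
    then show ?thesis by (metis of_real_eq_iff of_real_numeral)
  qed
  have tot2: "(\<integral>x. w2 x \<partial>lborel) = 2"
  proof -
    have "complex_of_real (\<integral>x. w2 x \<partial>lborel) = 2"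
      using ft2[of 0] by (simp add: scaleR_conv_of_real fourier_set_split_box_0)
    then show ?thesis by (metis of_real_eq_iff of_real_numeral)
  qed
  have orth1: "(\<integral>x. w1 x *\<^sub>R expo (\<xi> - \<eta>) x \<partial>lborel) = 0" if "\<xi> \<in> \<Lambda>" "\<eta> \<in> \<Lambda>" "\<xi> \<noteq> \<eta>" for \<xi> \<eta>
    using B that L2_inner_expo[OF O(1), of \<xi> \<eta>] unfolding L2_orthogonal_basis_def
    by (simp add: w1_def fourier_set_def)
  have orth2: "(\<integral>x. w2 x *\<^sub>R expo (\<xi> - \<eta>) x \<partial>lborel) = 0" if "\<xi> \<in> \<Lambda>" "\<eta> \<in> \<Lambda>" "\<xi> \<noteq> \<eta>" for \<xi> \<eta>
  proof -
    \<comment> \<open>Translating the box by \<open>- a\<close> instead of \<open>a\<close> merely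
      conjugates the mask factor, so zeros of the mask survive. The other zeros lie in
      \<open>grid_set\<close>, where the transform of the box vanishes.\<close>
    have "1 + expo (\<xi> - \<eta>) a = 0 \<or> \<xi> - \<eta> \<in> grid_set"
      using orth1[OF that] unfolding ft1 by (simp add: fourier_set_unit_cube_eq_0_iff)
    then show ?thesis
    proof
      assume "1 + expo (\<xi> - \<eta>) a = 0"
      then have "cnj (1 + expo (\<xi> - \<eta>) a) = 0" by simp
      then show ?thesis unfolding ft2 by simp
    qed (simp add: ft2 fourier_set_split_box_grid)
  qed
  \<comment> \<open>This gives \<open>A1 < m / 4\<close>, hence \<open>4 * A1 - 2 * m\<close> is
    below \<open>- m\<close>.\<close>
  define e where "e = sqrt m / 2"
  have "e > 0" using \<open>m > 0\<close> by (simp add: e_def)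
  have "indicator D \<in> L2_fun (lebesgue_on ?O)"
  proof -
    have "(indicator D :: _ \<Rightarrow> complex) \<in> borel_measurable (lebesgue_on ?O)"
      using Dm(1) by (intro measurable_restrict_space1 borel_measurable_indicator) simp
    moreover have "integrable (lebesgue_on ?O) (\<lambda>x. (norm (indicator D x :: complex))\<^sup>2)"
    proof (rule integrable_restrict_space[THEN iffD2])
      have "(\<lambda>x. indicator ?O x *\<^sub>R (norm (indicator D x :: complex))\<^sup>2) = (indicator D :: _ \<Rightarrow> real)"
        using DE(3) by (auto simp: indicator_def fun_eq_iff)
      then show "integrable lebesgue (\<lambda>x. indicator ?O x *\<^sub>R (norm (indicator D x :: complex))\<^sup>2)"
        using int[OF Dm] Dm by (simp add: integrable_completion)
    qed (use O in auto)
    ultimately show ?thesis by (simp add: L2_fun_def)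
  qed
  with B \<open>e > 0\<close> obtain F c where F: "finite F" "F \<subseteq> \<Lambda>"
    and less: "sqrt (\<integral>x. (norm (indicator D x - (\<Sum>i\<in>F. c i * expo i x)))\<^sup>2 \<partial>lebesgue_on ?O) < e"
    unfolding L2_orthogonal_basis_def by blast
  define p where "p x = (\<Sum>i\<in>F. c i * expo i x)" for x
  define A1 where "A1 = (\<integral>x. w1 x * (norm (indicator D x - of_real 1 * p x))\<^sup>2 \<partial>lborel)"
  \<comment> \<open>The factor 2 reflects the Fourier coefficients of the indicator of
    \<open>D\<close>: they scale with the weight on \<open>D\<close> over the total mass, which is
    1/2 for \<open>w1\<close> and 2/2 for \<open>w2\<close>.\<close>
  define A2 where "A2 = (\<integral>x. w2 x * (norm (indicator D x - of_real 2 * p x))\<^sup>2 \<partial>lborel)"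
  have "A1 < m / 4"
  proof -
    have "A1 = (\<integral>x. (norm (indicator D x - p x))\<^sup>2 \<partial>lebesgue_on ?O)"
      unfolding A1_def w1_def p_def by (subst lebesgue_on_integral_borel) (use O Dm in auto)
    then have "sqrt A1 < sqrt m / 2" using less by (simp add: e_def p_def)
    then have "sqrt A1 < sqrt (m / 4)" by (simp add: real_sqrt_divide)
    then show ?thesis by simp
  qed
  have "A2 \<ge> 0" unfolding A2_def w2_def by (intro Bochner_Integration.integral_nonneg) simp
  have "complex_of_real A1 = of_real 1 * of_real m - of_real (1 * 1) * (\<integral>x. indicator D x *\<^sub>R (p x + cnj (p x)) \<partial>lborel)
     + of_real (1\<^sup>2 * 2) * (\<Sum>\<xi>\<in>F. c \<xi> * cnj (c \<xi>))"
    unfolding A1_def m_def p_def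
  proof (rule weighted_square_expansion[OF w1 Dm _ F(1)])
    show "w1 x = 1" if "x \<in> D" for x
      using DE[OF that] by (simp add: w1_def)
  qed (use orth1 F tot1 in auto)
  moreover have "complex_of_real A2 = of_real 2 * of_real m - of_real (2 * 2) * (\<integral>x. indicator D x *\<^sub>R (p x + cnj (p x)) \<partial>lborel)
     + of_real (2\<^sup>2 * 2) * (\<Sum>\<xi>\<in>F. c \<xi> * cnj (c \<xi>))"
    unfolding A2_def m_def p_def
  proof (rule weighted_square_expansion[OF w2 Dm _ F(1)])
    show "w2 x = 2" if "x \<in> D" for x
      using DE[OF that] by (simp add: w2_def)
  qed (use orth2 F tot2 in auto)
  \<comment> \<open>The unknown linear part \<open>Z\<close> and quadratic part \<open>Y\<close> are
    eliminated together.\<close>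
  moreover have "y = 4 * x - 2 * u" if "x = of_real 1 * u - of_real (1 * 1) * Z + of_real (1\<^sup>2 * 2) * Y"
    "y = of_real 2 * u - of_real (2 * 2) * Z + of_real (2\<^sup>2 * 2) * Y" for x y u Y Z :: complex
    unfolding that by (simp add: algebra_simps)
  ultimately have "complex_of_real A2 = 4 * of_real A1 - 2 * of_real m" by blast
  then have "complex_of_real A2 = complex_of_real (4 * A1 - 2 * m)" by simp
  then have "A2 = 4 * A1 - 2 * m" by (simp only: of_real_eq_iff)
  then show False using \<open>A1 < m / 4\<close> \<open>A2 \<ge> 0\<close> \<open>m > 0\<close> by linarith
qed

section \<open>Density of trigonometric polynomials\<close>

text \<open>A closure under addition instead of sums over distinct frequencies: closure properties
  follow by rule induction, and like terms are collected only once, in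
  \<open>trig_poly_imp_sum\<close>.\<close>

inductive trig_poly :: "'a::real_inner set \<Rightarrow> ('a \<Rightarrow> complex) \<Rightarrow> bool" for L where
  monom: "\<xi> \<in> L \<Longrightarrow> trig_poly L (\<lambda>x. c * expo \<xi> x)"
| add: "trig_poly L p \<Longrightarrow> trig_poly L q \<Longrightarrow> trig_poly L (\<lambda>x. p x + q x)"

lemma trig_poly_cmult: "trig_poly L p \<Longrightarrow> trig_poly L (\<lambda>x. c * p x)"
proof (induction rule: trig_poly.induct)
  case (monom \<xi> d)
  then show ?case using trig_poly.monom[of \<xi> L "c * d"] by (simp add: mult.assoc)
next
  case (add p q)
  then show ?case using trig_poly.add by (fastforce simp: distrib_left)
qed

lemma trig_poly_mult_expo:
  assumes "trig_poly L p" "\<And>\<eta>. \<eta> \<in> L \<Longrightarrow> \<xi> + \<eta> \<in> L'"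
  shows "trig_poly L' (\<lambda>x. expo \<xi> x * p x)"
  using assms(1)
proof (induction rule: trig_poly.induct)
  case (monom \<eta> c)
  then show ?case using trig_poly.monom[OF assms(2), of \<eta> c] by (simp add: expo_add_left ac_simps)
next
  case (add p q)
  then show ?case using trig_poly.add by (fastforce simp: distrib_left)
qed

lemma trig_poly_mult:
  assumes "trig_poly L p" "trig_poly L q" "\<And>\<xi> \<eta>. \<xi> \<in> L \<Longrightarrow> \<eta> \<in> L \<Longrightarrow> \<xi> + \<eta> \<in> L"
  shows "trig_poly L (\<lambda>x. p x * q x)"
  using assms(1)
proof (induction rule: trig_poly.induct)
  case (monom \<xi> c)
  then show ?case
    using trig_poly_cmult[OF trig_poly_mult_expo[OF assms(2) assms(3)], of \<xi> c] by (simp add: mult.assoc)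
next
  case (add p r)
  then show ?case using trig_poly.add by (fastforce simp: distrib_right)
qed

lemma trig_poly_sum:
  assumes "finite A" "\<And>i. i \<in> A \<Longrightarrow> trig_poly L (p i)" "0 \<in> L"
  shows "trig_poly L (\<lambda>x. \<Sum>i\<in>A. p i x)"
  using assms(1,2)
proof (induction rule: finite_induct)
  case empty
  then show ?case using trig_poly.monom[OF assms(3), of 0] by simp
next
  case (insert i A)
  then show ?case using trig_poly.add[of L "p i" "\<lambda>x. \<Sum>i\<in>A. p i x"] by simp
qed

lemma trig_poly_mono: "trig_poly L p \<Longrightarrow> L \<subseteq> L' \<Longrightarrow> trig_poly L' p"
  by (induction rule: trig_poly.induct) (auto intro: trig_poly.intros)

lemma trig_poly_const: "0 \<in> L \<Longrightarrow> trig_poly L (\<lambda>x. c)"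
  using trig_poly.monom[of 0 L c] by simp

lemma trig_poly_continuous: "trig_poly L p \<Longrightarrow> continuous_on S p"
  by (induction rule: trig_poly.induct) (auto intro!: continuous_intros)

lemma trig_poly_borel: "trig_poly L p \<Longrightarrow> p \<in> borel_measurable borel"
  by (intro borel_measurable_continuous_onI trig_poly_continuous)

lemma trig_poly_imp_sum:
  assumes "trig_poly L p"
  shows "\<exists>F c. finite F \<and> F \<subseteq> L \<and> p = (\<lambda>x. \<Sum>i\<in>F. c i * expo i x)"
  using assms
proof (induction rule: trig_poly.induct)
  case (monom \<xi> c)
  then show ?case by (intro exI[of _ "{\<xi>}"] exI[of _ "\<lambda>_. c"]) simp
next
  case (add p q)
  then obtain F c G d where F: "finite F" "F \<subseteq> L" "p = (\<lambda>x. \<Sum>i\<in>F. c i * expo i x)"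
    and G: "finite G" "G \<subseteq> L" "q = (\<lambda>x. \<Sum>i\<in>G. d i * expo i x)" by blast
  \<comment> \<open>Coefficients extended by 0 to the union of the frequency sets, so that a shared
    frequency receives both contributions.\<close>
  let ?c = "\<lambda>i. (if i \<in> F then c i else 0)" and ?d = "\<lambda>i. (if i \<in> G then d i else 0)"
  have "p x + q x = (\<Sum>i\<in>F \<union> G. (?c i + ?d i) * expo i x)" for x
  proof -
    have "p x = (\<Sum>i\<in>F \<union> G. ?c i * expo i x)" unfolding F(3)
      by (rule sum.mono_neutral_cong_left) (use F G in auto)
    moreover have "q x = (\<Sum>i\<in>F \<union> G. ?d i * expo i x)" unfolding G(3)
      by (rule sum.mono_neutral_cong_left) (use F G in auto)
    ultimately show ?thesis by (simp add: distrib_right sum.distrib)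
  qed
  then show ?case using F G by (intro exI[of _ "F \<union> G"] exI[of _ "\<lambda>i. ?c i + ?d i"]) auto
qed

text \<open>Real and imaginary parts of \<open>expo (g i)\<close> are combinations of
  \<open>expo (g i)\<close> and \<open>expo (- g i)\<close>, as for cosine and sine. Real
  polynomials in these parts are what Stone-Weierstrass supplies on the torus.\<close>

lemma trig_poly_real_polynomial:
  fixes g :: "'n::finite \<Rightarrow> 'a::real_inner"
  assumes P: "real_polynomial_function P"
    and L: "0 \<in> L" "\<And>\<xi> \<eta>. \<xi> \<in> L \<Longrightarrow> \<eta> \<in> L \<Longrightarrow> \<xi> + \<eta> \<in> L" "\<And>i. g i \<in> L" "\<And>i. - g i \<in> L"
  shows "trig_poly L (\<lambda>x. of_real (P (\<chi> i. expo (g i) x)))"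
  using P
proof (induction rule: real_polynomial_function.induct)
  case (linear f)
  interpret bounded_linear f by fact
  have "trig_poly L (\<lambda>x. of_real ((\<chi> i. expo (g i) x) \<bullet> b) :: complex)" if b: "b \<in> Basis" for b :: "complex ^ 'n"
  proof -
    obtain i u where iu: "b = axis i u" "u \<in> Basis" using b by (auto simp: Basis_vec_def)
    have 1: "trig_poly L (\<lambda>x. c * expo (g i) x + d * expo (- g i) x)" for c d
      using L by (intro trig_poly.intros)
    have "u = 1 \<or> u = \<i>" using iu(2) by (auto simp: Basis_complex_def)
    then show ?thesis
    proof
      assume u: "u = 1"
      have "of_real ((\<chi> i. expo (g i) x) \<bullet> b) = 1/2 * expo (g i) x + 1/2 * expo (- g i) x" for x
        by (simp add: iu(1) u inner_axis expo_minus_left complex_eq_iff)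
      then show ?thesis using 1[of "1/2" "1/2"] by simp
    next
      assume u: "u = \<i>"
      have "of_real ((\<chi> i. expo (g i) x) \<bullet> b) = - \<i> / 2 * expo (g i) x + \<i> / 2 * expo (- g i) x" for x
        by (simp add: iu(1) u inner_axis expo_minus_left complex_eq_iff)
      then show ?thesis using 1[of "- \<i> / 2" "\<i> / 2"] by simp
    qed
  qed
  then have S: "trig_poly L (\<lambda>x. \<Sum>b\<in>Basis. of_real (f b) * of_real ((\<chi> i. expo (g i) x) \<bullet> b) :: complex)"
    using L(1) by (intro trig_poly_sum trig_poly_cmult) auto
  have expand: "of_real (f z) = (\<Sum>b\<in>Basis. of_real (f b) * of_real (z \<bullet> b) :: complex)" for z
  proof -
    have "f z = f (\<Sum>b\<in>Basis. (z \<bullet> b) *\<^sub>R b)" by (simp add: euclidean_representation)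
    also have "\<dots> = (\<Sum>b\<in>Basis. f b * (z \<bullet> b))" by (simp add: sum scaleR mult.commute)
    finally show ?thesis by simp
  qed
  have "(\<lambda>x. complex_of_real (f (\<chi> i. expo (g i) x))) =
    (\<lambda>x. \<Sum>b\<in>Basis. of_real (f b) * of_real ((\<chi> i. expo (g i) x) \<bullet> b))"
    by (rule ext, rule expand)
  from arg_cong[OF this, of "trig_poly L"] S show ?case by blast
next
  case (const c)
  then show ?case using L(1) by (rule trig_poly_const)
next
  case (add f g)
  show ?case unfolding of_real_add by (rule trig_poly.add) (rule add.IH)+
next
  case (mult f g)
  show ?case unfolding of_real_mult by (rule trig_poly_mult) (rule mult.IH L(2), assumption?)+
qed

section \<open>Mean square approximation\<close>

text \<open>With squared errors and tolerances in \<open>ennreal\<close>, no approximant has to be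
  checked for integrability.\<close>

definition L2_approx :: "'a measure \<Rightarrow> (('a \<Rightarrow> complex) \<Rightarrow> bool) \<Rightarrow> ('a \<Rightarrow> complex) \<Rightarrow> bool" where
  "L2_approx M A f \<longleftrightarrow> (\<forall>\<epsilon>>0. \<exists>p. A p \<and> p \<in> borel_measurable M \<and> (\<integral>\<^sup>+x. ennreal ((norm (f x - p x))\<^sup>2) \<partial>M) < \<epsilon>)"

text \<open>It replaces the triangle inequality in L2 when errors are kept squared. The factors 2
  are why tolerances are later split into quarters.\<close>

lemma norm_add_squared_le: "(norm (u + v))\<^sup>2 \<le> 2 * (norm u)\<^sup>2 + 2 * (norm v)\<^sup>2" for u v :: "'a::real_normed_vector"
proof -
  have "(norm (u + v))\<^sup>2 \<le> (norm u + norm v)\<^sup>2" by (intro power_mono norm_triangle_ineq norm_ge_zero)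
  also have "\<dots> \<le> 2 * (norm u)\<^sup>2 + 2 * (norm v)\<^sup>2"
    using sum_squares_bound[of "norm u" "norm v"] by (simp add: power2_sum)
  finally show ?thesis .
qed

lemma nn_integral_norm_add_squared_le:
  fixes u v :: "'a \<Rightarrow> complex"
  assumes [measurable]: "u \<in> borel_measurable M" "v \<in> borel_measurable M"
  shows "(\<integral>\<^sup>+x. ennreal ((norm (u x + v x))\<^sup>2) \<partial>M) \<le>
    2 * (\<integral>\<^sup>+x. ennreal ((norm (u x))\<^sup>2) \<partial>M) + 2 * (\<integral>\<^sup>+x. ennreal ((norm (v x))\<^sup>2) \<partial>M)"
proof -
  have "(\<integral>\<^sup>+x. ennreal ((norm (u x + v x))\<^sup>2) \<partial>M) \<le> (\<integral>\<^sup>+x. 2 * ennreal ((norm (u x))\<^sup>2) + 2 * ennreal ((norm (v x))\<^sup>2) \<partial>M)"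
  proof (rule nn_integral_mono)
    fix x
    have "ennreal ((norm (u x + v x))\<^sup>2) \<le> ennreal (2 * (norm (u x))\<^sup>2 + 2 * (norm (v x))\<^sup>2)"
      by (intro ennreal_leI norm_add_squared_le)
    then show "ennreal ((norm (u x + v x))\<^sup>2) \<le> 2 * ennreal ((norm (u x))\<^sup>2) + 2 * ennreal ((norm (v x))\<^sup>2)"
      by (simp add: ennreal_plus ennreal_mult)
  qed
  also have "\<dots> = 2 * (\<integral>\<^sup>+x. ennreal ((norm (u x))\<^sup>2) \<partial>M) + 2 * (\<integral>\<^sup>+x. ennreal ((norm (v x))\<^sup>2) \<partial>M)"
    by (simp add: nn_integral_add nn_integral_cmult)
  finally show ?thesis .
qed

lemma ennreal_quarters: "a < \<epsilon> / 4 \<Longrightarrow> b < \<epsilon> / 4 \<Longrightarrow> 2 * a + 2 * b < (\<epsilon> :: ennreal)"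
proof -
  assume ab: "a < \<epsilon> / 4" "b < \<epsilon> / 4"
  show ?thesis
  proof (cases "\<epsilon> = top")
    case True
    have "a < top" "b < top" using ab by (auto intro: order_less_le_trans)
    then show ?thesis using True by (simp add: ennreal_mult_less_top)
  next
    case False
    then obtain e where e: "\<epsilon> = ennreal e" "0 \<le> e" by (cases \<epsilon>) auto
    have "a < top" "b < top" using ab by (auto intro: order_less_le_trans)
    then obtain r s where rs: "a = ennreal r" "0 \<le> r" "b = ennreal s" "0 \<le> s"
      by (cases a; cases b) auto
    have q: "\<epsilon> / 4 = ennreal (e / 4)" using e divide_ennreal[of e 4] by simp
    have "r < e / 4" "s < e / 4" using ab rs unfolding q by (simp_all add: ennreal_less_iff)
    then have "2 * r + 2 * s < e" by simp
    then have "ennreal (2 * r + 2 * s) < ennreal e" using rs by (intro ennreal_lessI) linarith+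
    then show ?thesis using rs e by (simp add: ennreal_plus ennreal_mult)
  qed
qed

lemma L2_approx_add:
  assumes A: "\<And>p q. A p \<Longrightarrow> A q \<Longrightarrow> A (\<lambda>x. p x + q x)"
    and f: "L2_approx M A f" "f \<in> borel_measurable M" and g: "L2_approx M A g" "g \<in> borel_measurable M"
  shows "L2_approx M A (\<lambda>x. f x + g x)"
  unfolding L2_approx_def
proof (intro allI impI)
  note [measurable] = f(2) g(2)
  fix \<epsilon> :: ennreal assume "\<epsilon> > 0"
  then have e: "\<epsilon> / 4 > 0" by (simp add: ennreal_zero_less_divide)
  obtain p where p: "A p" "p \<in> borel_measurable M" "(\<integral>\<^sup>+x. ennreal ((norm (f x - p x))\<^sup>2) \<partial>M) < \<epsilon> / 4"
    using f(1) e unfolding L2_approx_def by blast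
  obtain q where q: "A q" "q \<in> borel_measurable M" "(\<integral>\<^sup>+x. ennreal ((norm (g x - q x))\<^sup>2) \<partial>M) < \<epsilon> / 4"
    using g(1) e unfolding L2_approx_def by blast
  note [measurable] = p(2) q(2)
  have "(\<integral>\<^sup>+x. ennreal ((norm (f x + g x - (p x + q x)))\<^sup>2) \<partial>M) =
    (\<integral>\<^sup>+x. ennreal ((norm ((f x - p x) + (g x - q x)))\<^sup>2) \<partial>M)"
    by (simp add: add_diff_add)
  also have "\<dots> \<le> 2 * (\<integral>\<^sup>+x. ennreal ((norm (f x - p x))\<^sup>2) \<partial>M) + 2 * (\<integral>\<^sup>+x. ennreal ((norm (g x - q x))\<^sup>2) \<partial>M)"
    by (rule nn_integral_norm_add_squared_le) measurable
  also have "\<dots> < \<epsilon>" by (rule ennreal_quarters[OF p(3) q(3)])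
  finally show "\<exists>p. A p \<and> p \<in> borel_measurable M \<and> (\<integral>\<^sup>+x. ennreal ((norm (f x + g x - p x))\<^sup>2) \<partial>M) < \<epsilon>"
    using A[OF p(1) q(1)] by (intro exI[of _ "\<lambda>x. p x + q x"]) auto
qed

lemma L2_approx_zero: "A (\<lambda>x. 0) \<Longrightarrow> L2_approx M A (\<lambda>x. 0)"
  unfolding L2_approx_def by (intro allI impI exI[of _ "\<lambda>x. 0"]) auto

lemma L2_approx_cmult:
  assumes A: "\<And>p c. A p \<Longrightarrow> A (\<lambda>x. c * p x)" and "A (\<lambda>x. 0)" and f: "L2_approx M A f" "f \<in> borel_measurable M"
  shows "L2_approx M A (\<lambda>x. c * f x)"
proof (cases "c = 0")
  case True
  then show ?thesis using L2_approx_zero[of A M] assms(2) by simp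
next
  case False
  define k where "k = ennreal ((norm c)\<^sup>2)"
  have k: "k > 0" "k < top" using False by (simp_all add: k_def)
  show ?thesis unfolding L2_approx_def
  proof (intro allI impI)
    note [measurable] = f(2)
    fix \<epsilon> :: ennreal assume "\<epsilon> > 0"
    then have "\<epsilon> / k > 0" using k by (simp add: ennreal_zero_less_divide)
    then obtain p where p: "A p" "p \<in> borel_measurable M" "(\<integral>\<^sup>+x. ennreal ((norm (f x - p x))\<^sup>2) \<partial>M) < \<epsilon> / k"
      using f(1) unfolding L2_approx_def by blast
    note [measurable] = p(2)
    have "(norm (c * f x - c * p x))\<^sup>2 = (norm c)\<^sup>2 * (norm (f x - p x))\<^sup>2" for x
      by (simp add: right_diff_distrib[symmetric] norm_mult power_mult_distrib)
    then have "(\<integral>\<^sup>+x. ennreal ((norm (c * f x - c * p x))\<^sup>2) \<partial>M) = k * (\<integral>\<^sup>+x. ennreal ((norm (f x - p x))\<^sup>2) \<partial>M)"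
      unfolding k_def by (simp add: ennreal_mult nn_integral_cmult)
    also have "\<dots> < k * (\<epsilon> / k)" using p(3) k by (intro ennreal_mult_strict_left_mono) auto
    also have "\<dots> = \<epsilon>" using k by (simp add: ennreal_times_divide mult.commute[of k] ennreal_mult_divide_eq)
    finally show "\<exists>p. A p \<and> p \<in> borel_measurable M \<and> (\<integral>\<^sup>+x. ennreal ((norm (c * f x - p x))\<^sup>2) \<partial>M) < \<epsilon>"
      using A[OF p(1)] by (intro exI[of _ "\<lambda>x. c * p x"]) auto
  qed
qed

text \<open>Simple functions dominated by a multiple of \<open>f\<close> converge to it in mean
  square, and each is a finite combination of indicators.\<close>

lemma L2_approx_of_indicators:
  assumes A: "\<And>p q. A p \<Longrightarrow> A q \<Longrightarrow> A (\<lambda>x. p x + q x)" "\<And>p c. A p \<Longrightarrow> A (\<lambda>x. c * p x)" "A (\<lambda>x. 0)"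
    and ind: "\<And>S. S \<in> sets M \<Longrightarrow> L2_approx M A (indicator S)"
    and f: "f \<in> L2_fun M"
  shows "L2_approx M A f"
proof -
  have fm[measurable]: "f \<in> borel_measurable M" and fi: "integrable M (\<lambda>x. (norm (f x))\<^sup>2)"
    using f by (auto simp: L2_fun_def)
  obtain s where s: "\<And>i. simple_function M (s i)" "\<And>x. x \<in> space M \<Longrightarrow> (\<lambda>i. s i x) \<longlonglongrightarrow> f x"
    "\<And>i x. x \<in> space M \<Longrightarrow> dist (s i x) 0 \<le> 2 * dist (f x) 0"
    using borel_measurable_implies_sequence_metric[OF fm, of 0] by blast
  have [measurable]: "s i \<in> borel_measurable M" for i using s(1) by (rule borel_measurable_simple_function)
  have simple: "L2_approx M A (s i)" for i
  proof -
    have fin: "finite (s i ` space M)" using s(1) by (simp add: simple_function_def)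
    have m: "s i -` {y} \<inter> space M \<in> sets M" for y by measurable
    have "L2_approx M A (\<lambda>x. \<Sum>y\<in>Y. y * indicator (s i -` {y} \<inter> space M) x)" if "finite Y" for Y
      using that
    proof (induction rule: finite_induct)
      case empty
      then show ?case using L2_approx_zero[of A M] A(3) by simp
    next
      case (insert y Y)
      have "L2_approx M A (\<lambda>x. y * indicator (s i -` {y} \<inter> space M) x + (\<Sum>y\<in>Y. y * indicator (s i -` {y} \<inter> space M) x))"
        using m by (intro L2_approx_add[where A=A, OF A(1)] insert L2_approx_cmult A ind) measurable
      then show ?case unfolding sum.insert[OF insert.hyps(1,2)] .
    qed
    from this[OF fin] have "L2_approx M A (\<lambda>x. \<Sum>y\<in>s i ` space M. y * indicator (s i -` {y} \<inter> space M) x)" .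
    moreover have "(\<Sum>y\<in>s i ` space M. y * indicator (s i -` {y} \<inter> space M) x) = s i x" if "x \<in> space M" for x
    proof -
      have "(\<Sum>y\<in>s i ` space M. y * indicator (s i -` {y} \<inter> space M) x) = (\<Sum>y\<in>s i ` space M. if y = s i x then y else 0)"
        using that by (intro sum.cong) (auto simp: indicator_def)
      then show ?thesis using fin that by simp
    qed
    ultimately show ?thesis unfolding L2_approx_def by (simp cong: nn_integral_cong)
  qed
  have "(\<lambda>i. \<integral>\<^sup>+x. ennreal ((norm (f x - s i x))\<^sup>2) \<partial>M) \<longlonglongrightarrow> (\<integral>\<^sup>+x. 0 \<partial>M)"
  \<comment> \<open>The constant is 3 squared: the simple functions are bounded by twice
    \<open>norm (f x)\<close>, so the difference is at most three times it.\<close>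
  proof (rule nn_integral_dominated_convergence[where w="\<lambda>x. ennreal (9 * (norm (f x))\<^sup>2)"])
    have "integrable M (\<lambda>x. 9 * (norm (f x))\<^sup>2)" using fi by simp
    then show "(\<integral>\<^sup>+x. ennreal (9 * (norm (f x))\<^sup>2) \<partial>M) < \<infinity>"
      by (subst nn_integral_eq_integral) auto
    show "AE x in M. ennreal ((norm (f x - s i x))\<^sup>2) \<le> ennreal (9 * (norm (f x))\<^sup>2)" for i
    proof (rule AE_I2)
      fix x assume x: "x \<in> space M"
      have "norm (f x - s i x) \<le> 3 * norm (f x)"
        using norm_triangle_ineq4[of "f x" "s i x"] s(3)[OF x, of i] by simp
      then have "(norm (f x - s i x))\<^sup>2 \<le> (3 * norm (f x))\<^sup>2" by (intro power_mono) auto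
      then show "ennreal ((norm (f x - s i x))\<^sup>2) \<le> ennreal (9 * (norm (f x))\<^sup>2)"
        by (intro ennreal_leI) (simp add: power_mult_distrib)
    qed
    show "AE x in M. (\<lambda>i. ennreal ((norm (f x - s i x))\<^sup>2)) \<longlonglongrightarrow> 0"
    proof (rule AE_I2)
      fix x assume x: "x \<in> space M"
      have "(\<lambda>i. (norm (f x - s i x))\<^sup>2) \<longlonglongrightarrow> (norm (f x - f x))\<^sup>2"
        by (intro tendsto_intros s(2) x)
      then have "(\<lambda>i. ennreal ((norm (f x - s i x))\<^sup>2)) \<longlonglongrightarrow> ennreal ((norm (f x - f x))\<^sup>2)"
        by (rule tendsto_ennrealI)
      then show "(\<lambda>i. ennreal ((norm (f x - s i x))\<^sup>2)) \<longlonglongrightarrow> 0" by simp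
    qed
  qed auto
  then have lim: "(\<lambda>i. \<integral>\<^sup>+x. ennreal ((norm (f x - s i x))\<^sup>2) \<partial>M) \<longlonglongrightarrow> 0" by simp
  show ?thesis unfolding L2_approx_def
  proof (intro allI impI)
    fix \<epsilon> :: ennreal assume "\<epsilon> > 0"
    then have e: "\<epsilon> / 4 > 0" by (simp add: ennreal_zero_less_divide)
    obtain i where i: "(\<integral>\<^sup>+x. ennreal ((norm (f x - s i x))\<^sup>2) \<partial>M) < \<epsilon> / 4"
      using order_tendstoD(2)[OF lim e] by (auto simp: eventually_sequentially)
    obtain p where p: "A p" "p \<in> borel_measurable M" "(\<integral>\<^sup>+x. ennreal ((norm (s i x - p x))\<^sup>2) \<partial>M) < \<epsilon> / 4"
      using simple e unfolding L2_approx_def by blast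
    note [measurable] = p(2)
    have "(\<integral>\<^sup>+x. ennreal ((norm (f x - p x))\<^sup>2) \<partial>M) =
      (\<integral>\<^sup>+x. ennreal ((norm ((f x - s i x) + (s i x - p x)))\<^sup>2) \<partial>M)" by simp
    also have "\<dots> \<le> 2 * (\<integral>\<^sup>+x. ennreal ((norm (f x - s i x))\<^sup>2) \<partial>M) + 2 * (\<integral>\<^sup>+x. ennreal ((norm (s i x - p x))\<^sup>2) \<partial>M)"
      by (rule nn_integral_norm_add_squared_le) measurable
    also have "\<dots> < \<epsilon>" by (rule ennreal_quarters[OF i p(3)])
    finally show "\<exists>p. A p \<and> p \<in> borel_measurable M \<and> (\<integral>\<^sup>+x. ennreal ((norm (f x - p x))\<^sup>2) \<partial>M) < \<epsilon>"
      using p by blast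
  qed
qed

text \<open>The map \<phi> sends \<open>K\<close> into a torus, where trigonometric polynomials are
  ordinary polynomials. A set is enclosed between a closed and an open set by regularity, a Urysohn
  function on the torus separates the images, and Stone-Weierstrass replaces it by a polynomial.
  Separation is required only between a point of \<open>Q\<close> and one of \<open>K\<close>, since
  opposite faces of a closed cube may be identified by \<phi>.\<close>

lemma L2_approx_trig_poly:
  fixes g :: "'n::finite \<Rightarrow> 'a::euclidean_space"
  assumes Q: "open Q" "Q \<subseteq> K" "compact K"
    and L: "0 \<in> L" "\<And>\<xi> \<eta>. \<xi> \<in> L \<Longrightarrow> \<eta> \<in> L \<Longrightarrow> \<xi> + \<eta> \<in> L" "\<And>i. g i \<in> L" "\<And>i. - g i \<in> L"
    and sep: "\<And>x y. x \<in> Q \<Longrightarrow> y \<in> K \<Longrightarrow> (\<And>i. expo (g i) x = expo (g i) y) \<Longrightarrow> x = y"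
    and f: "f \<in> L2_fun (lebesgue_on Q)"
  shows "L2_approx (lebesgue_on Q) (trig_poly L) f"
proof (rule L2_approx_of_indicators[OF _ _ _ _ f])
  fix S assume "S \<in> sets (lebesgue_on Q)"
  have Qm: "Q \<in> sets lebesgue" using Q(1) by simp
  then have S: "S \<in> sets lebesgue" "S \<subseteq> Q" using \<open>S \<in> sets (lebesgue_on Q)\<close> by (auto simp: sets_restrict_space_iff)
  have "bounded Q" using Q compact_imp_bounded bounded_subset by blast
  then have Qfin: "emeasure lebesgue Q < \<infinity>"
    using emeasure_bounded_finite[of Q] Q(1) by simp
  define m where "m = measure lebesgue Q"
  have m: "emeasure lebesgue Q = ennreal m" "0 \<le> m"
    using Qfin by (simp_all add: m_def emeasure_eq_ennreal_measure)
  define \<phi> where "\<phi> x = (\<chi> i. expo (g i) x)" for x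
  have cont: "continuous_on A \<phi>" for A unfolding \<phi>_def by (intro continuous_intros)
  show "L2_approx (lebesgue_on Q) (trig_poly L) (indicator S)"
    unfolding L2_approx_def
  proof (intro allI impI)
    fix \<epsilon> :: ennreal assume "\<epsilon> > 0"
    \<comment> \<open>The tolerance may be infinite, so a real number below it is fixed
      first.\<close>
    then obtain e where e: "0 < e" "ennreal e \<le> \<epsilon>"
      by (cases \<epsilon>) (auto intro: that[of 1] that)
    have "0 < e / 8" using e by simp
    obtain U where U: "open U" "S \<subseteq> U" "emeasure lebesgue (U - S) < ennreal (e / 8)" "U - S \<in> lmeasurable"
      using sets_lebesgue_outer_open[OF S(1) \<open>0 < e / 8\<close>] by metis
    obtain C where C: "closed C" "C \<subseteq> S" "emeasure lebesgue (S - C) < ennreal (e / 8)" "S - C \<in> lmeasurable"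
      using sets_lebesgue_inner_closed[OF S(1) \<open>0 < e / 8\<close>] by metis
    have cC: "compact C"
      using C S \<open>bounded Q\<close> by (meson bounded_subset compact_eq_bounded_closed)
    have cKU: "compact (K - (U \<inter> Q))" by (intro compact_diff open_Int Q U)
    \<comment> \<open>\<open>\<phi>\<close> need not be injective on \<open>K\<close>, so the cutoff function is chosen on the image of \<open>\<phi>\<close>.\<close>
    have "\<phi> ` C \<inter> \<phi> ` (K - (U \<inter> Q)) = {}"
    proof -
      have False if "x \<in> C" "y \<in> K - (U \<inter> Q)" "\<phi> x = \<phi> y" for x y
      proof -
        have "expo (g i) x = expo (g i) y" for i using that(3) by (simp add: \<phi>_def vec_eq_iff)
        then have "x = y" using that C S by (intro sep) auto
        then show False using that C S U by blast
      qed
      then show ?thesis by blast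
    qed
    moreover have "closed (\<phi> ` C)" "closed (\<phi> ` (K - (U \<inter> Q)))"
      using cC cKU cont by (auto intro: compact_imp_closed compact_continuous_image)
    ultimately obtain h :: "complex ^ 'n \<Rightarrow> real" where h: "continuous_on UNIV h" "\<And>z. h z \<in> closed_segment 1 0"
      "\<And>z. z \<in> \<phi> ` C \<Longrightarrow> h z = 1" "\<And>z. z \<in> \<phi> ` (K - (U \<inter> Q)) \<Longrightarrow> h z = 0"
      using Urysohn[of "\<phi> ` C" "\<phi> ` (K - (U \<inter> Q))" "1::real" 0] by metis
    have h01: "0 \<le> h z" "h z \<le> 1" for z using h(2)[of z] by (auto simp: closed_segment_eq_real_ivl)
    \<comment> \<open>Chosen so that the uniform error contributes
      \<open>2 * \<delta>\<^sup>2 * m\<close>, at most \<open>e / 4\<close>; adding 1 to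
      \<open>m\<close> avoids division by zero. The exceptional set contributes at most
      \<open>e / 2\<close>.\<close>
    define \<delta> where "\<delta> = sqrt (e / (8 * (m + 1)))"
    have \<delta>: "\<delta> > 0" "\<delta>\<^sup>2 = e / (8 * (m + 1))" using e m by (simp_all add: \<delta>_def)
    have "compact (\<phi> ` K)" using Q(3) cont by (intro compact_continuous_image)
    then obtain P where P: "real_polynomial_function P" "\<And>z. z \<in> \<phi> ` K \<Longrightarrow> \<bar>h z - P z\<bar> < \<delta>"
      using Stone_Weierstrass_real_polynomial_function[OF _ continuous_on_subset[OF h(1)] \<delta>(1)] by blast
    define p where "p x = complex_of_real (P (\<phi> x))" for x
    have tp: "trig_poly L p"
      using trig_poly_real_polynomial[OF P(1) L] unfolding p_def \<phi>_def .
    have pm: "p \<in> borel_measurable (lebesgue_on Q)"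
      using trig_poly_borel[OF tp] by (intro measurable_restrict_space1 measurable_completion) simp
    \<comment> \<open>Within \<open>Q\<close> the cutoff agrees with the indicator of
      \<open>S\<close> off this set: both are 1 on \<open>C\<close> and 0 outside
      \<open>U\<close>.\<close>
    define B where "B = U \<inter> Q - C"
    have UC: "U \<in> sets lebesgue" "C \<in> sets lebesgue" using U(1) C(1) by simp_all
    then have Bm: "B \<in> sets lebesgue" unfolding B_def using Qm by (intro sets.Diff sets.Int)
    have "emeasure lebesgue B \<le> ennreal (e / 4)"
    proof -
      have "emeasure lebesgue B \<le> emeasure lebesgue ((U - S) \<union> (S - C))"
        unfolding B_def using UC S(1) by (intro emeasure_mono sets.Un sets.Diff) auto
      also have "\<dots> \<le> emeasure lebesgue (U - S) + emeasure lebesgue (S - C)"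
        using UC S(1) by (intro emeasure_subadditive sets.Diff)
      also have "\<dots> \<le> ennreal (e / 8) + ennreal (e / 8)" using U C by (intro add_mono less_imp_le)
      also have "\<dots> = ennreal (e / 4)" using e by (simp flip: ennreal_plus)
      finally show ?thesis .
    qed
    have pt: "(norm (indicator S x - p x))\<^sup>2 \<le> 2 * indicator B x + 2 * \<delta>\<^sup>2" if "x \<in> Q" for x
    proof -
      have "\<bar>indicator S x - h (\<phi> x)\<bar> \<le> indicator B x"
      proof -
        consider "x \<in> C" | "x \<in> B" | "x \<in> K - (U \<inter> Q)" using \<open>x \<in> Q\<close> Q by (auto simp: B_def)
        then show ?thesis
        proof cases
          case 1
          then show ?thesis using h(3) C by auto
        next
          case 2
          then show ?thesis using h01[of "\<phi> x"] by (auto simp: indicator_def)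
        next
          case 3
          then have "x \<notin> S" using U S by auto
          then show ?thesis using h(4) 3 by simp
        qed
      qed
      then have "(indicator S x - h (\<phi> x))\<^sup>2 \<le> (indicator B x)\<^sup>2"
        by (intro abs_le_square_iff[THEN iffD1]) simp
      moreover have "(indicator B x)\<^sup>2 = (indicator B x :: real)" by (simp add: indicator_def)
      ultimately have 1: "(norm (indicator S x - h (\<phi> x)))\<^sup>2 \<le> indicator B x"
        by (simp only: real_norm_def power2_abs)
      have "\<bar>h (\<phi> x) - P (\<phi> x)\<bar> \<le> \<delta>" using P(2)[of "\<phi> x"] that Q by auto
      then have 2: "(norm (h (\<phi> x) - P (\<phi> x)))\<^sup>2 \<le> \<delta>\<^sup>2" by (intro power_mono) auto
      have "norm (indicator S x - p x) = norm (complex_of_real ((indicator S x - h (\<phi> x)) + (h (\<phi> x) - P (\<phi> x))))"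
        by (simp add: p_def indicator_def)
      also have "\<dots> = norm ((indicator S x - h (\<phi> x)) + (h (\<phi> x) - P (\<phi> x)))" by (rule norm_of_real[unfolded real_norm_def[symmetric]])
      finally have eq: "norm (indicator S x - p x) = norm ((indicator S x - h (\<phi> x)) + (h (\<phi> x) - P (\<phi> x)))" .
      show ?thesis unfolding eq using norm_add_squared_le[of "indicator S x - h (\<phi> x)" "h (\<phi> x) - P (\<phi> x)"] 1 2 by linarith
    qed
    have "(\<integral>\<^sup>+x. ennreal ((norm (indicator S x - p x))\<^sup>2) \<partial>lebesgue_on Q) \<le>
      (\<integral>\<^sup>+x. 2 * indicator B x + ennreal (2 * \<delta>\<^sup>2) \<partial>lebesgue_on Q)"
    proof (rule nn_integral_mono)
      fix x assume "x \<in> space (lebesgue_on Q)"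
      then have "ennreal ((norm (indicator S x - p x))\<^sup>2) \<le> ennreal (2 * indicator B x + 2 * \<delta>\<^sup>2)"
        by (intro ennreal_leI pt) simp
      also have "\<dots> = 2 * indicator B x + ennreal (2 * \<delta>\<^sup>2)"
        by (cases "x \<in> B") (simp_all add: ennreal_plus)
      finally show "ennreal ((norm (indicator S x - p x))\<^sup>2) \<le> 2 * indicator B x + ennreal (2 * \<delta>\<^sup>2)" .
    qed
    also have "\<dots> = 2 * emeasure lebesgue B + ennreal (2 * \<delta>\<^sup>2) * emeasure lebesgue Q"
    proof -
      have [measurable]: "B \<in> sets (lebesgue_on Q)" using Bm Qm by (auto simp: sets_restrict_space_iff B_def)
      have "emeasure (lebesgue_on Q) B = emeasure lebesgue B" "emeasure (lebesgue_on Q) Q = emeasure lebesgue Q"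
        by (rule emeasure_restrict_space; use Qm in \<open>auto simp: B_def\<close>)+
      then show ?thesis by (simp add: nn_integral_add nn_integral_cmult)
    qed
    also have "\<dots> \<le> 2 * ennreal (e / 4) + ennreal (2 * \<delta>\<^sup>2) * ennreal m"
      unfolding m(1) using \<open>emeasure lebesgue B \<le> ennreal (e / 4)\<close> by (intro add_mono mult_left_mono) auto
    also have "\<dots> = ennreal (e / 2 + 2 * \<delta>\<^sup>2 * m)"
    proof -
      have "2 * ennreal (e / 4) = ennreal (e / 2)" using ennreal_mult[of 2 "e / 4"] e by simp
      then show ?thesis using e m by (simp add: ennreal_mult ennreal_plus)
    qed
    also have "\<dots> < ennreal e"
    proof (rule ennreal_lessI)
      have "2 * \<delta>\<^sup>2 * m = (e / 4) * (m / (m + 1))" using m by (simp add: \<delta>(2) field_simps)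
      also have "\<dots> \<le> (e / 4) * 1" using e m by (intro mult_left_mono) auto
      finally show "e / 2 + 2 * \<delta>\<^sup>2 * m < e" using e by linarith
    qed (rule e)
    also note e(2)
    finally show "\<exists>p. trig_poly L p \<and> p \<in> borel_measurable (lebesgue_on Q) \<and>
        (\<integral>\<^sup>+x. ennreal ((norm (indicator S x - p x))\<^sup>2) \<partial>lebesgue_on Q) < \<epsilon>"
      using tp pm by blast
  qed
qed (use L in \<open>auto intro: trig_poly.add trig_poly_cmult trig_poly_const\<close>)

section \<open>Splitting two cubes into one, and the explicit spectrum\<close>

text \<open>A translation is an affine map with all scaling factors 1. The statement concerns
  \<open>lebesgue\<close>, because L2 functions on \<Omega> need not be Borel measurable.\<close>

lemma nn_integral_lebesgue_translate:
  fixes a :: "'a::euclidean_space"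
  assumes f: "f \<in> borel_measurable lebesgue"
  shows "(\<lambda>x. a + x) \<in> lebesgue \<rightarrow>\<^sub>M lebesgue" "(\<integral>\<^sup>+x. f (a + x) \<partial>lebesgue) = (\<integral>\<^sup>+x. f x \<partial>lebesgue)"
proof -
  have T: "a + (\<Sum>j\<in>Basis. (1 * (x \<bullet> j)) *\<^sub>R j) = a + x" for x by (simp add: euclidean_representation)
  show m: "(\<lambda>x. a + x) \<in> lebesgue \<rightarrow>\<^sub>M lebesgue"
    using lebesgue_affine_measurable[of "\<lambda>_. 1" a] unfolding T by simp
  have "lebesgue = distr lebesgue lebesgue (\<lambda>x. a + x)"
    using lebesgue_affine_euclidean[of "\<lambda>_. 1" a] unfolding T by (simp add: density_1)
  then have "(\<integral>\<^sup>+x. f x \<partial>lebesgue) = (\<integral>\<^sup>+x. f x \<partial>distr lebesgue lebesgue (\<lambda>x. a + x))" by simp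
  also have "\<dots> = (\<integral>\<^sup>+x. f (a + x) \<partial>lebesgue)" by (rule nn_integral_distr) (use m f in \<open>simp_all add: measurable_distr_eq1\<close>)
  finally show "(\<integral>\<^sup>+x. f (a + x) \<partial>lebesgue) = (\<integral>\<^sup>+x. f x \<partial>lebesgue)" by simp
qed

text \<open>This identifies a function on \<Omega> with the pair of its restrictions to the two
  cubes, both read on the unit cube.\<close>

lemma nn_integral_two_cubes:
  fixes a :: "real ^ 'n"
  assumes disj: "unit_cube \<inter> (\<lambda>x. x + a) ` unit_cube = {}"
    and F: "F \<in> borel_measurable (lebesgue_on ({0, a} + unit_cube))"
  shows "(\<integral>\<^sup>+x. F x \<partial>lebesgue_on ({0, a} + unit_cube)) =
    (\<integral>\<^sup>+x. F x \<partial>lebesgue_on unit_cube) + (\<integral>\<^sup>+x. F (a + x) \<partial>lebesgue_on unit_cube)"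
proof -
  let ?O = "{0, a} + unit_cube" and ?Q = "unit_cube :: (real ^ 'n) set"
  have O: "?O \<in> sets lebesgue" by (rule sets_completionI_sets) (simp add: borel_two_cubes)
  have Q: "?Q \<in> sets lebesgue" by (rule sets_completionI_sets) (simp add: open_unit_cube)
  \<comment> \<open>Extension by zero gives a function measurable on the whole space, to which the
    translation formula applies.\<close>
  define G where "G x = F x * indicator ?O x" for x
  have G[measurable]: "G \<in> borel_measurable lebesgue"
    unfolding G_def using F O by (subst (asm) borel_measurable_restrict_space_iff_ennreal) auto
  have ma: "(\<lambda>x. - a + x) \<in> lebesgue \<rightarrow>\<^sub>M lebesgue"
    by (rule nn_integral_lebesgue_translate(1)[OF G])
  have Qa: "(\<lambda>x. indicator ?Q (- a + x) :: ennreal) \<in> borel_measurable lebesgue"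
    by (rule measurable_compose[OF ma borel_measurable_indicator[OF Q]])
  have split: "G x = G x * indicator ?Q x + G x * indicator ?Q (- a + x)" for x
    using two_cubes_disjoint[OF disj, of x] by (auto simp: G_def two_cubes_mem indicator_def)
  have "(\<integral>\<^sup>+x. F x \<partial>lebesgue_on ?O) = (\<integral>\<^sup>+x. G x \<partial>lebesgue)"
    using O by (simp add: nn_integral_restrict_space G_def)
  also have "\<dots> = (\<integral>\<^sup>+x. G x * indicator ?Q x \<partial>lebesgue) + (\<integral>\<^sup>+x. G x * indicator ?Q (- a + x) \<partial>lebesgue)"
    using G Q Qa by (subst split, intro nn_integral_add borel_measurable_times_ennreal borel_measurable_indicator)
  also have "(\<integral>\<^sup>+x. G x * indicator ?Q (- a + x) \<partial>lebesgue) = (\<integral>\<^sup>+x. G (a + x) * indicator ?Q (- a + (a + x)) \<partial>lebesgue)"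
    using G Qa by (intro nn_integral_lebesgue_translate(2)[symmetric] borel_measurable_times_ennreal)
  also have "\<dots> = (\<integral>\<^sup>+x. F (a + x) \<partial>lebesgue_on ?Q)"
    using Q by (simp add: nn_integral_restrict_space) (auto intro!: nn_integral_cong simp: G_def two_cubes_mem indicator_def)
  also have "(\<integral>\<^sup>+x. G x * indicator ?Q x \<partial>lebesgue) = (\<integral>\<^sup>+x. F x \<partial>lebesgue_on ?Q)"
    using Q by (simp add: nn_integral_restrict_space) (auto intro!: nn_integral_cong simp: G_def two_cubes_mem indicator_def)
  finally show ?thesis .
qed

lemma L2_fun_iff: "f \<in> L2_fun M \<longleftrightarrow> f \<in> borel_measurable M \<and> (\<integral>\<^sup>+x. ennreal ((norm (f x))\<^sup>2) \<partial>M) < \<infinity>"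
  unfolding L2_fun_def by (auto simp: integrable_iff_bounded)

lemma L2_fun_add:
  assumes "f \<in> L2_fun M" "g \<in> L2_fun M"
  shows "(\<lambda>x. f x + g x) \<in> L2_fun M"
proof -
  have "(\<integral>\<^sup>+x. ennreal ((norm (f x + g x))\<^sup>2) \<partial>M) \<le>
    2 * (\<integral>\<^sup>+x. ennreal ((norm (f x))\<^sup>2) \<partial>M) + 2 * (\<integral>\<^sup>+x. ennreal ((norm (g x))\<^sup>2) \<partial>M)"
    using assms by (intro nn_integral_norm_add_squared_le) (auto simp: L2_fun_iff)
  also have "\<dots> < \<infinity>" using assms by (simp add: L2_fun_iff ennreal_mult_less_top)
  finally show ?thesis using assms by (auto simp: L2_fun_iff)
qed

lemma L2_fun_mult_bounded:
  assumes "f \<in> L2_fun M" "u \<in> borel_measurable M" "\<And>x. norm (u x) \<le> 1"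
  shows "(\<lambda>x. u x * f x) \<in> L2_fun M"
proof -
  have "(\<integral>\<^sup>+x. ennreal ((norm (u x * f x))\<^sup>2) \<partial>M) \<le> (\<integral>\<^sup>+x. ennreal ((norm (f x))\<^sup>2) \<partial>M)"
    using assms(3) by (intro nn_integral_mono ennreal_leI power_mono) (auto simp: norm_mult mult_left_le_one_le)
  also have "\<dots> < \<infinity>" using assms by (simp add: L2_fun_iff)
  finally show ?thesis using assms by (auto simp: L2_fun_iff)
qed

text \<open>Exponentials from \<open>L\<close> take equal values at x and a + x, those from
  \<open>b + L\<close> opposite values. They therefore represent half the sum and half the
  difference of the two restrictions of a function, and completeness reduces to density of the span
  of \<open>L\<close> on one cube.\<close>

lemma grid_set_imp_spectral:
  fixes a :: "real ^ 'n"
  assumes disj: "unit_cube \<inter> (\<lambda>x. x + a) ` unit_cube = {}"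
    and a: "a \<in> grid_set"
  shows "is_spectral_set ({0, a} + unit_cube)"
proof -
  let ?O = "{0, a} + unit_cube" and ?Q = "unit_cube :: (real ^ 'n) set"
  obtain i n where n: "a $ i = of_int n" "n \<noteq> 0"
    using a by (auto simp: grid_set_def elim!: Ints_cases)
  \<comment> \<open>\<open>L\<close> is the dual of the lattice generated by \<open>a / n\<close> and the unit vectors other than the \<open>i\<close>-th.
    Its exponentials are periodic under \<open>a\<close>, while \<open>expo b\<close> changes sign under \<open>a\<close>.\<close>
  define L where "L = {l :: real ^ 'n. (\<forall>j. j \<noteq> i \<longrightarrow> l $ j \<in> \<int>) \<and> (l \<bullet> a) / of_int n \<in> \<int>}"
  define b :: "real ^ 'n" where "b = axis i (1 / (2 * of_int n))"
  define \<Lambda> where "\<Lambda> = L \<union> (+) b ` L"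
  have L0: "0 \<in> L" by (simp add: L_def)
  have Ladd: "\<xi> + \<eta> \<in> L" if "\<xi> \<in> L" "\<eta> \<in> L" for \<xi> \<eta>
    using that by (auto simp: L_def inner_add_left add_divide_distrib)
  have Lminus: "- \<xi> \<in> L" if "\<xi> \<in> L" for \<xi> using that by (auto simp: L_def)
  have Ldiff: "\<xi> - \<eta> \<in> L" if "\<xi> \<in> L" "\<eta> \<in> L" for \<xi> \<eta>
    using Ladd[OF that(1) Lminus[OF that(2)]] by simp
  have La: "expo \<xi> a = 1" if "\<xi> \<in> L" for \<xi>
  proof -
    have "of_int n * ((\<xi> \<bullet> a) / of_int n) \<in> \<int>" using that by (intro Ints_mult) (auto simp: L_def)
    then show ?thesis using n(2) by (simp add: expo_eq_1_iff)
  qed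
  have ba: "expo b a = - 1"
  proof -
    have "b \<bullet> a = 1 / 2" using n by (simp add: b_def inner_axis')
    then have "expo b a = exp (of_real pi * \<i>)" unfolding expo_def by (simp only:) simp
    then show ?thesis by simp
  qed
  have zero: "fourier_set ?O (\<xi> - \<eta>) = 0" if "\<xi> \<in> \<Lambda>" "\<eta> \<in> \<Lambda>" "\<xi> \<noteq> \<eta>" for \<xi> \<eta>
  proof -
    \<comment> \<open>Frequencies in the same coset of \<open>L\<close> differ by an element of
      \<open>L\<close>, those in different cosets by one of \<open>b + L\<close> or
      \<open>- b + L\<close>. In the latter case the mask factor vanishes.\<close>
    have "\<xi> - \<eta> \<in> L \<or> (\<exists>l\<in>L. \<xi> - \<eta> = b + l) \<or> (\<exists>l\<in>L. \<xi> - \<eta> = - b + l)"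
    proof -
      have "\<exists>l s. \<zeta> = s + l \<and> l \<in> L \<and> (s = 0 \<or> s = b)" if "\<zeta> \<in> \<Lambda>" for \<zeta>
        using that unfolding \<Lambda>_def by (metis UnE add_0 imageE)
      then obtain l s l' s' where l: "\<xi> = s + l" "l \<in> L" "s = 0 \<or> s = b" "\<eta> = s' + l'" "l' \<in> L" "s' = 0 \<or> s' = b"
        using \<open>\<xi> \<in> \<Lambda>\<close> \<open>\<eta> \<in> \<Lambda>\<close> by metis
      have eq: "\<xi> - \<eta> = (s - s') + (l - l')" unfolding l(1,4) by (rule add_diff_add)
      have lL: "l - l' \<in> L" using l by (intro Ldiff)
      from l(3,6) show ?thesis
      proof (elim disjE)
        assume "s = b" "s' = 0"
        then show ?thesis using eq lL by (metis diff_zero)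
      next
        assume "s = 0" "s' = b"
        then show ?thesis using eq lL by (metis diff_0)
      qed (use eq lL in simp_all)
    qed
    then consider "\<xi> - \<eta> \<in> L" | l where "l \<in> L" "\<xi> - \<eta> = b + l" | l where "l \<in> L" "\<xi> - \<eta> = - b + l" by blast
    then show ?thesis
    proof cases
      case 1
      \<comment> \<open>A nonzero element of \<open>L\<close> has a nonzero integer coordinate:
        either one other than \<open>i\<close>, or, if all these vanish, coordinate \<open>i\<close>
        itself, which then equals the inner product with \<open>a / n\<close>.\<close>
      have "\<xi> - \<eta> \<in> grid_set"
      proof (cases "\<exists>j. j \<noteq> i \<and> (\<xi> - \<eta>) $ j \<noteq> 0")
        case True
        then obtain j where "j \<noteq> i" "(\<xi> - \<eta>) $ j \<noteq> 0" by blast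
        moreover have "(\<xi> - \<eta>) $ j \<in> \<int>" using 1 \<open>j \<noteq> i\<close> by (simp add: L_def)
        ultimately show ?thesis unfolding grid_set_def by blast
      next
        case False
        then have eq: "\<xi> - \<eta> = axis i ((\<xi> - \<eta>) $ i)" by (auto simp: vec_eq_iff axis_def)
        then have "(\<xi> - \<eta>) \<bullet> a = (\<xi> - \<eta>) $ i * of_int n" using n(1) by (metis inner_axis' inner_real_def)
        then have "(\<xi> - \<eta>) $ i \<in> \<int>" using 1 n(2) by (simp add: L_def)
        moreover have "(\<xi> - \<eta>) $ i \<noteq> 0" using eq that(3) by (metis axis_eq_0_iff right_minus_eq)
        ultimately show ?thesis unfolding grid_set_def by blast
      qed
      then show ?thesis using fourier_set_two_cubes[OF disj] fourier_set_unit_cube_eq_0_iff by (metis mult_zero_right)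
    next
      case 2
      then have "expo (\<xi> - \<eta>) a = - 1" by (simp add: expo_add_left La ba)
      then show ?thesis by (simp add: fourier_set_two_cubes[OF disj])
    next
      case 3
      then have "expo (\<xi> - \<eta>) a = - 1" by (simp add: expo_diff_left La ba)
      then show ?thesis by (simp add: fourier_set_two_cubes[OF disj])
    qed
  qed
  have "countable L"
  proof -
    let ?c = "\<lambda>l. (\<chi> j. if j = i then \<lfloor>(l \<bullet> a) / of_int n\<rfloor> else \<lfloor>l $ j\<rfloor>) :: int ^ 'n"
    \<comment> \<open>On \<open>L\<close> the floors are exact, so they record all coordinates
      except \<open>i\<close> and the inner product with \<open>a\<close>; the latter determines
      coordinate \<open>i\<close> because \<open>n\<close> is nonzero.\<close>
    have "inj_on ?c L"
    proof (rule inj_onI)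
      fix l l' assume l: "l \<in> L" "l' \<in> L" "?c l = ?c l'"
      have "(\<chi> j. if j = i then (l \<bullet> a) / of_int n else l $ j) = (\<chi> j. if j = i then (l' \<bullet> a) / of_int n else l' $ j)"
        (is "?r l = ?r l'")
      proof -
        have "?r l $ j = of_int (?c l $ j)" if "l \<in> L" for l j using that by (auto simp: L_def)
        then show ?thesis using l by (simp add: vec_eq_iff)
      qed
      then have r: "(if j = i then (l \<bullet> a) / of_int n else l $ j) = (if j = i then (l' \<bullet> a) / of_int n else l' $ j)" for j
        by (simp add: vec_eq_iff)
      have j: "l $ j = l' $ j" if "j \<noteq> i" for j using r[of j] that by simp
      have "l \<bullet> a = l' \<bullet> a" using r[of i] n by simp
      then have "(l - l') \<bullet> a = 0" by (simp add: inner_diff_left)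
      moreover have "l - l' = axis i ((l - l') $ i)" using j by (auto simp: vec_eq_iff axis_def)
      ultimately have "(l - l') $ i * a $ i = 0" by (metis inner_axis' inner_real_def)
      then have "l $ i = l' $ i" using n by simp
      then show "l = l'" using j by (metis vec_eq_iff)
    qed
    then show ?thesis by (rule countable_image_inj_on[rotated]) simp
  qed
  then have "countable \<Lambda>" by (simp add: \<Lambda>_def)
  \<comment> \<open>The basis of \<open>L\<close> dual to \<open>a / n\<close> and the unit vectors
    other than the \<open>i\<close>-th; the correction along \<open>i\<close> makes the inner
    product with \<open>a\<close> vanish.\<close>
  define g :: "'n \<Rightarrow> real ^ 'n" where "g j = (if j = i then axis i 1 else axis j 1 - axis i (a $ j / of_int n))" for j
  have gL: "g j \<in> L" for j
  proof -
    have "(g j \<bullet> a) / of_int n \<in> \<int>" using n by (simp add: g_def inner_diff_left inner_axis')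
    moreover have "g j $ k \<in> \<int>" if "k \<noteq> i" for k using that by (simp add: g_def axis_def)
    ultimately show ?thesis by (simp add: L_def)
  qed
  have sep: "x = y" if x: "x \<in> ?Q" and y: "y \<in> cbox 0 1" and e: "\<And>j. expo (g j) x = expo (g j) y" for x y
  proof -
    have int: "g j \<bullet> (x - y) \<in> \<int>" for j
    proof -
      have "expo (g j) (x - y) = 1" using e[of j] expo_add_right[of "g j" "x - y" y] by simp
      then show ?thesis by (simp add: expo_eq_1_iff)
    qed
    have small: "x $ j - y $ j = 0" if "x $ j - y $ j \<in> \<int>" for j
    proof -
      have "\<bar>x $ j - y $ j\<bar> < 1"
      proof -
        have "0 < x $ j" "x $ j < 1" using x by (simp_all add: unit_cube_def)
        moreover have "0 \<le> y $ j" "y $ j \<le> 1" using y by (simp_all add: mem_box_cart)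
        ultimately show ?thesis by linarith
      qed
      then show ?thesis using that Ints_nonzero_abs_less1 by blast
    qed
    \<comment> \<open>Coordinate \<open>i\<close> comes first: once it agrees, the correction term
      drops out of \<open>g j\<close>, which then tests coordinate \<open>j\<close> alone.
      Coordinates differ by less than 1 since \<open>x\<close> is in the open cube and
      \<open>y\<close> in its closure.\<close>
    have i0: "x $ i - y $ i = 0" using int[of i] by (intro small) (simp add: g_def inner_axis')
    have "x $ j - y $ j = 0" for j
    proof (cases "j = i")
      case False
      then show ?thesis using int[of j] i0 by (intro small) (simp add: g_def inner_diff_left inner_axis')
    qed (use i0 in simp)
    then show ?thesis by (simp add: vec_eq_iff)
  qed
  have QK: "?Q \<subseteq> cbox 0 1" by (simp add: unit_cube_eq_box box_subset_cbox)
  have dense: "L2_approx (lebesgue_on ?Q) (trig_poly L) f" if "f \<in> L2_fun (lebesgue_on ?Q)" for f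
  proof (rule L2_approx_trig_poly[OF open_unit_cube QK compact_cbox L0 _ _ _ _ that])
    show "g j \<in> L" "- g j \<in> L" for j using gL Lminus by auto
  qed (fact Ladd sep)+
  \<comment> \<open>Hence approximants built on the first cube are automatically prescribed on the
    second.\<close>
  have per: "p (a + x) = p x" if "trig_poly L p" for p x
    using that by (induction rule: trig_poly.induct) (simp_all add: expo_add_right La)
  have Obor: "?O \<in> sets borel" by (rule borel_two_cubes)
  have QO: "?Q \<subseteq> ?O" "(\<lambda>x. a + x) ` ?Q \<subseteq> ?O" by (auto simp: two_cubes_mem)
  have complete: "\<exists>F c. finite F \<and> F \<subseteq> \<Lambda> \<and> sqrt (\<integral>x. (norm (f x - (\<Sum>i\<in>F. c i * expo i x)))\<^sup>2 \<partial>lebesgue_on ?O) < \<epsilon>"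
    if f: "f \<in> L2_fun (lebesgue_on ?O)" and "\<epsilon> > 0" for f and \<epsilon> :: real
  proof -
    have fm[measurable]: "f \<in> borel_measurable (lebesgue_on ?O)" using f by (simp add: L2_fun_iff)
    have mQ: "(\<lambda>x. x) \<in> lebesgue_on ?Q \<rightarrow>\<^sub>M lebesgue_on ?O"
      by (intro measurable_restrict_space2 measurable_restrict_space1) (use QO in auto)
    have mA: "(\<lambda>x. a + x) \<in> lebesgue_on ?Q \<rightarrow>\<^sub>M lebesgue_on ?O"
      by (intro measurable_restrict_space2 measurable_restrict_space1 nn_integral_lebesgue_translate(1)[of "\<lambda>_. 0"])
        (use QO in auto)
    have f0m: "f \<in> borel_measurable (lebesgue_on ?Q)" using measurable_compose[OF mQ fm] .
    have f1m: "(\<lambda>x. f (a + x)) \<in> borel_measurable (lebesgue_on ?Q)" using measurable_compose[OF mA fm] .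
    have "(\<integral>\<^sup>+x. ennreal ((norm (f x))\<^sup>2) \<partial>lebesgue_on ?O) < \<infinity>" using f by (simp add: L2_fun_iff)
    then have f0: "f \<in> L2_fun (lebesgue_on ?Q)" and f1: "(\<lambda>x. f (a + x)) \<in> L2_fun (lebesgue_on ?Q)"
      using f0m f1m by (simp_all add: L2_fun_iff nn_integral_two_cubes[OF disj])
    have em[measurable]: "expo \<xi> \<in> borel_measurable (lebesgue_on S)" for \<xi> :: "real ^ 'n" and S
      by (intro measurable_restrict_space1 measurable_completion) simp
    define A where "A x = 1 / 2 * (f x + f (a + x))" for x
    \<comment> \<open>The factor \<open>expo (- b)\<close> removes the shift from the antisymmetric
      half, so both halves are approximated with frequencies in \<open>L\<close>. On the unit cube
      \<open>f x = A x + expo b x * B x\<close>, and the sign of the second term flips at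
      \<open>a + x\<close>.\<close>
    define B where "B x = (1 / 2 * expo (- b) x) * (f x + (- 1) * f (a + x))" for x
    have A: "A \<in> L2_fun (lebesgue_on ?Q)" unfolding A_def
      by (intro L2_fun_mult_bounded L2_fun_add f0 f1) auto
    have B: "B \<in> L2_fun (lebesgue_on ?Q)" unfolding B_def
      by (intro L2_fun_mult_bounded[of _ _ "\<lambda>x. 1 / 2 * expo (- b) x"] L2_fun_mult_bounded[of _ _ "\<lambda>_. - 1"] L2_fun_add f0 f1 borel_measurable_times)
        (auto simp: norm_mult)
    \<comment> \<open>Each cube may use half of \<open>\<epsilon>\<^sup>2\<close>, and each of the
      two halves of \<open>f\<close> a quarter of that.\<close>
    define \<delta> where "\<delta> = ennreal (\<epsilon>\<^sup>2 / 8)"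
    have \<delta>: "\<delta> > 0" using \<open>\<epsilon> > 0\<close> by (simp add: \<delta>_def)
    obtain G where G: "trig_poly L G" "G \<in> borel_measurable (lebesgue_on ?Q)"
      "(\<integral>\<^sup>+x. ennreal ((norm (A x - G x))\<^sup>2) \<partial>lebesgue_on ?Q) < \<delta>"
      using dense[OF A] \<delta> unfolding L2_approx_def by blast
    obtain H where H: "trig_poly L H" "H \<in> borel_measurable (lebesgue_on ?Q)"
      "(\<integral>\<^sup>+x. ennreal ((norm (B x - H x))\<^sup>2) \<partial>lebesgue_on ?Q) < \<delta>"
      using dense[OF B] \<delta> unfolding L2_approx_def by blast
    define p where "p x = G x + expo b x * H x" for x
    have "trig_poly \<Lambda> p" unfolding p_def
      by (intro trig_poly.add trig_poly_mono[OF G(1)] trig_poly_mult_expo[OF H(1)]) (auto simp: \<Lambda>_def)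
    then obtain F c where F: "finite F" "F \<subseteq> \<Lambda>" "p = (\<lambda>x. \<Sum>i\<in>F. c i * expo i x)"
      using trig_poly_imp_sum by blast
    have pm[measurable]: "p \<in> borel_measurable (lebesgue_on ?O)"
      using trig_poly_borel[OF \<open>trig_poly \<Lambda> p\<close>] by (intro measurable_restrict_space1 measurable_completion) simp
    have ebb: "expo b x * expo (- b) x = 1" for x by (simp flip: expo_add_left)
    have e0: "f x - p x = (A x - G x) + expo b x * (B x - H x)" for x
    proof -
      have "A x + expo b x * B x = 1/2 * (f x + f (a + x)) + 1/2 * (expo b x * expo (- b) x) * (f x - f (a + x))"
        by (simp add: A_def B_def)
      also have "\<dots> = f x" unfolding ebb by (simp add: algebra_simps)
      finally show ?thesis by (simp add: p_def algebra_simps)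
    qed
    have e1: "f (a + x) - p (a + x) = (A x - G x) + (- expo b x) * (B x - H x)" for x
    proof -
      have "A x - expo b x * B x = 1/2 * (f x + f (a + x)) - 1/2 * (expo b x * expo (- b) x) * (f x - f (a + x))"
        by (simp add: A_def B_def)
      also have "\<dots> = f (a + x)" unfolding ebb by (simp add: algebra_simps)
      finally show ?thesis by (simp add: p_def per[OF G(1)] per[OF H(1)] expo_add_right ba algebra_simps)
    qed
    have bound: "(\<integral>\<^sup>+x. ennreal ((norm ((A x - G x) + u x * (B x - H x)))\<^sup>2) \<partial>lebesgue_on ?Q) < ennreal (\<epsilon>\<^sup>2 / 2)"
      if u: "u \<in> borel_measurable (lebesgue_on ?Q)" "\<And>x. norm (u x) = 1" for u
    proof -
      have [measurable]: "A \<in> borel_measurable (lebesgue_on ?Q)" "B \<in> borel_measurable (lebesgue_on ?Q)"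
        using A B by (simp_all add: L2_fun_iff)
      note [measurable] = G(2) H(2) u(1)
      have "(\<integral>\<^sup>+x. ennreal ((norm ((A x - G x) + u x * (B x - H x)))\<^sup>2) \<partial>lebesgue_on ?Q) \<le>
        2 * (\<integral>\<^sup>+x. ennreal ((norm (A x - G x))\<^sup>2) \<partial>lebesgue_on ?Q)
        + 2 * (\<integral>\<^sup>+x. ennreal ((norm (u x * (B x - H x)))\<^sup>2) \<partial>lebesgue_on ?Q)"
        by (rule nn_integral_norm_add_squared_le) measurable
      also have "\<dots> < ennreal (\<epsilon>\<^sup>2 / 2)"
      proof (rule ennreal_quarters)
        have "ennreal (\<epsilon>\<^sup>2 / 2) / 4 = \<delta>" using divide_ennreal[of "\<epsilon>\<^sup>2 / 2" 4] by (simp add: \<delta>_def)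
        then show "(\<integral>\<^sup>+x. ennreal ((norm (A x - G x))\<^sup>2) \<partial>lebesgue_on ?Q) < ennreal (\<epsilon>\<^sup>2 / 2) / 4"
          "(\<integral>\<^sup>+x. ennreal ((norm (u x * (B x - H x)))\<^sup>2) \<partial>lebesgue_on ?Q) < ennreal (\<epsilon>\<^sup>2 / 2) / 4"
          using G(3) H(3) by (simp_all add: norm_mult u(2))
      qed
      finally show ?thesis .
    qed
    have "(\<integral>\<^sup>+x. ennreal ((norm (f x - p x))\<^sup>2) \<partial>lebesgue_on ?O) =
      (\<integral>\<^sup>+x. ennreal ((norm (f x - p x))\<^sup>2) \<partial>lebesgue_on ?Q) + (\<integral>\<^sup>+x. ennreal ((norm (f (a + x) - p (a + x)))\<^sup>2) \<partial>lebesgue_on ?Q)"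
      by (rule nn_integral_two_cubes[OF disj]) measurable
    also have "\<dots> < ennreal (\<epsilon>\<^sup>2 / 2) + ennreal (\<epsilon>\<^sup>2 / 2)"
    proof (rule add_strict_mono)
      show "(\<integral>\<^sup>+x. ennreal ((norm (f x - p x))\<^sup>2) \<partial>lebesgue_on ?Q) < ennreal (\<epsilon>\<^sup>2 / 2)"
        unfolding e0 by (rule bound) auto
      show "(\<integral>\<^sup>+x. ennreal ((norm (f (a + x) - p (a + x)))\<^sup>2) \<partial>lebesgue_on ?Q) < ennreal (\<epsilon>\<^sup>2 / 2)"
        unfolding e1 by (rule bound) auto
    qed
    also have "\<dots> = ennreal (\<epsilon>\<^sup>2)" by (simp flip: ennreal_plus)
    finally have nn: "(\<integral>\<^sup>+x. ennreal ((norm (f x - p x))\<^sup>2) \<partial>lebesgue_on ?O) < ennreal (\<epsilon>\<^sup>2)" .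
    have "(\<integral>x. (norm (f x - p x))\<^sup>2 \<partial>lebesgue_on ?O) = enn2real (\<integral>\<^sup>+x. ennreal ((norm (f x - p x))\<^sup>2) \<partial>lebesgue_on ?O)"
      by (rule integral_eq_nn_integral) (auto intro: borel_measurable_power)
    also have "\<dots> < \<epsilon>\<^sup>2"
      using nn by (cases "\<integral>\<^sup>+x. ennreal ((norm (f x - p x))\<^sup>2) \<partial>lebesgue_on ?O") (auto simp: ennreal_less_iff)
    finally have "sqrt (\<integral>x. (norm (f x - p x))\<^sup>2 \<partial>lebesgue_on ?O) < sqrt (\<epsilon>\<^sup>2)" by (rule real_sqrt_less_mono)
    then show ?thesis using F \<open>\<epsilon> > 0\<close> by (intro exI[of _ F] exI[of _ c]) simp
  qed
  have "expo \<xi> \<in> L2_fun (lebesgue_on ?O)" for \<xi>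
  proof -
    have "expo \<xi> \<in> borel_measurable (lebesgue_on ?O)"
      by (intro measurable_restrict_space1 measurable_completion) simp
    moreover have "(\<integral>\<^sup>+x. ennreal ((norm (expo \<xi> x))\<^sup>2) \<partial>lebesgue_on ?O) < \<infinity>"
      using emeasure_bounded_finite[OF bounded_two_cubes, of a] Obor
      by (simp add: emeasure_restrict_space)
    ultimately show ?thesis by (simp add: L2_fun_iff)
  qed
  moreover have "L2_inner (lebesgue_on ?O) (expo \<xi>) (expo \<xi>) \<noteq> 0" for \<xi>
    by (simp add: L2_inner_expo[OF Obor] fourier_set_two_cubes[OF disj] fourier_set_unit_cube_0)
  ultimately have "L2_orthogonal_basis (lebesgue_on ?O) expo \<Lambda>"
    unfolding L2_orthogonal_basis_def using complete by (auto simp: L2_inner_expo[OF Obor] zero)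
  then show ?thesis unfolding is_spectral_set_def using \<open>countable \<Lambda>\<close> by blast
qed

theorem theorem1p4:
  fixes a :: "real ^ 'n" and \<Omega> :: "(real ^ 'n) set"
  assumes disj: "unit_cube \<inter> (\<lambda>x. x + a) ` unit_cube = {}"
    and Omega: "\<Omega> = {0, a} + unit_cube"
  shows "(is_weak_tile \<Omega> \<longleftrightarrow> is_tile \<Omega>) \<and>
         (is_tile \<Omega> \<longleftrightarrow> is_spectral_set \<Omega>) \<and>
         (is_spectral_set \<Omega> \<longleftrightarrow> a \<in> grid_set)"
proof -
  have "\<Omega> \<noteq> {}"
  proof -
    have "(\<chi> i. 1 / 2) \<in> \<Omega>" unfolding Omega two_cubes_mem by (simp add: unit_cube_def)
    then show ?thesis by blast
  qed
  moreover have "open \<Omega>" unfolding Omega by (rule open_two_cubes)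
  ultimately have "is_tile \<Omega> \<Longrightarrow> is_weak_tile \<Omega>" using is_tile_imp_is_weak_tile by blast
  moreover have "is_weak_tile \<Omega> \<Longrightarrow> a \<in> grid_set"
    unfolding Omega by (rule weak_tile_imp_grid_set[OF disj])
  moreover have "a \<in> grid_set \<Longrightarrow> is_tile \<Omega>" unfolding Omega by (rule grid_set_imp_is_tile)
  moreover have "is_spectral_set \<Omega> \<Longrightarrow> a \<in> grid_set"
    unfolding Omega by (rule spectral_imp_grid_set[OF disj])
  moreover have "a \<in> grid_set \<Longrightarrow> is_spectral_set \<Omega>"
    unfolding Omega by (rule grid_set_imp_spectral[OF disj])
  ultimately show ?thesis by blast
qed

end
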